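(* Thompson's group $T$ is not invariably generated.
   Context: $S^1$ is the interval $[0,1]$ with $0$ and $1$ identified. Thompson's group $T$ is the group of piecewise linear orientation-preserving homeomorphisms of $S^1$ which preserve the set of finite dyadic fractions, have finitely many breakpoints, all at finite dyadic fractions, and all slopes integer powers of $2$. A group $G$ is invariably generated if there is a subset $S\subseteq G$ such that $G=\langle s^{g(s)}: s\in S\rangle$ for every choice of $g(s)\in G$, $s\in S$; equivalently, no proper subgroup of $G$ meets every conjugacy class of $G$. *)

theory Defs
  imports Complex_Main "HOL-Algebra.Generated_Groups"
begin

definition dyadic :: "real \<Rightarrow> bool" where
  "dyadic x \<longleftrightarrow> (\<exists>m::int. \<exists>n::nat. x = real_of_int m / 2 ^ n)"

text \<open>S^1 = [0,1] with 0 ~ 1, represented by [0,1) via frac.  An element of T is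
  given through its lift F : R -> R (a continuous, strictly increasing map with
  F(x+1) = F(x) + 1, i.e. an orientation-preserving circle homeomorphism), which is
  piecewise linear with finitely many breakpoints in [0,1], all dyadic, all slopes
  integer powers of 2, and which preserves the dyadic rationals.\<close>
definition thompson_lift :: "(real \<Rightarrow> real) \<Rightarrow> bool" where
  "thompson_lift F \<longleftrightarrow>
     continuous_on UNIV F \<and> strict_mono F \<and> (\<forall>x. F (x + 1) = F x + 1) \<and>
     (\<forall>x. dyadic x \<longleftrightarrow> dyadic (F x)) \<and>
     (\<exists>B. finite B \<and> (\<forall>b\<in>B. dyadic b) \<and>
        (\<forall>x\<in>{0..1} - B. \<exists>k::int. \<exists>e>0. \<forall>y. \<bar>y - x\<bar> < e \<longrightarrow>
              F y = F x + 2 powr (real_of_int k) * (y - x)))"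

definition thompson_T_set :: "(real \<Rightarrow> real) set" where
  "thompson_T_set = {(\<lambda>x. frac (F x)) | F. thompson_lift F}"

definition thompson_T :: "(real \<Rightarrow> real) monoid" where
  "thompson_T = \<lparr>carrier = thompson_T_set, mult = (\<circ>), one = frac\<rparr>"

definition invariably_generated :: "('a, 'b) monoid_scheme \<Rightarrow> bool" where
  "invariably_generated G \<longleftrightarrow>
     (\<exists>S \<subseteq> carrier G. \<forall>g \<in> S \<rightarrow> carrier G.
        generate G ((\<lambda>s. inv\<^bsub>G\<^esub> (g s) \<otimes>\<^bsub>G\<^esub> s \<otimes>\<^bsub>G\<^esub> g s) ` S) = carrier G)"

end

theory Submission
  imports Defs "HOL-Algebra.Group_Action" "HOL-Library.Countable_Set" "HOL-Library.Disjoint_Sets"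
begin

text \<open>
  Ping-pong. Suppose that every \<open>s \<in> T\<close> has an interval \<open>I\<close> of the circle with
  \<open>s\<^sup>k I \<inter> I = {}\<close> whenever \<open>s\<^sup>k \<noteq> 1\<close>. Since \<open>T\<close> is countable, one can choose
  pairwise disjoint intervals \<open>J\<^sub>s \<subseteq> [0, 1/2)\<close>, and an element \<open>g\<^sub>s \<in> T\<close> that maps the
  complement of \<open>J\<^sub>s\<close> into \<open>I\<close>. The nontrivial powers of the conjugate of \<open>s\<close> by \<open>g\<^sub>s\<close>
  then map the complement of \<open>J\<^sub>s\<close> into \<open>J\<^sub>s\<close>, so the orbit of \<open>1/2\<close> under the group
  generated by these conjugates lies in \<open>{1/2} \<union> (\<Union>s. J\<^sub>s)\<close>. It misses \<open>3/4\<close>, although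
  the rotation by \<open>1/4\<close> belongs to \<open>T\<close>.

  The interval \<open>I\<close> exists as soon as \<open>s\<close> has a periodic point, say of minimal period \<open>q\<close>: a power
  of \<open>s\<close> that maps some point of a gap of the periodic orbit back into this gap fixes the end points
  of the gap, hence is a power of \<open>s\<^sup>q\<close>. If \<open>s\<^sup>q = 1\<close>, any gap will do; otherwise take the
  interval between a point \<open>c\<close> and \<open>s\<^sup>q c \<noteq> c\<close>.

  Periodic points exist because the lift \<open>F\<close> maps all short standard dyadic intervals
  \<open>[i/2\<^sup>d, (i+1)/2\<^sup>d]\<close> to such intervals. As \<open>F\<^sup>n 1 - F\<^sup>n 0 = 1\<close> for all \<open>n\<close>, bisection yields a
  nested sequence of standard dyadic intervals whose forward images do not shrink to length \<open>0\<close>.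
  If the images of one of them are eventually all standard dyadic, then infinitely many of these
  are longer than some positive bound; otherwise every interval of the sequence grows to a standard
  dyadic one longer than a fixed bound, which takes the shorter intervals more and more time.
  In both cases two of the long images agree modulo \<open>1\<close>. Since the original intervals are nested,
  an iterate of \<open>F\<close> maps some interval to one that contains it or is contained in it modulo \<open>1\<close>,
  and the intermediate value theorem provides a fixed point.
\<close>

section \<open>Ping-pong and invariable generation\<close>

lemma (in group) int_pow_conj:
  assumes "s \<in> carrier G" "g \<in> carrier G"
  shows "(inv g \<otimes> s \<otimes> g) [^] (k::int) = inv g \<otimes> s [^] k \<otimes> g"
proof -
  have cancel: "g \<otimes> (inv g \<otimes> x) = x" if "x \<in> carrier G" for x
    using assms(2) that by (simp flip: m_assoc)
  interpret conj: group_hom G G "\<lambda>x. inv g \<otimes> x \<otimes> g"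
    by (unfold_locales, rule homI) (use assms(2) in \<open>auto simp: m_assoc cancel\<close>)
  show ?thesis using conj.hom_int_pow[OF assms(1), of k] by simp
qed

context group_action
begin

interpretation group G
  by (rule group_hom.axioms(1)[OF group_hom])

definition wandering :: "'a \<Rightarrow> 'c set \<Rightarrow> bool" where
  "wandering s A \<longleftrightarrow> (\<forall>k::int. \<forall>x\<in>A. \<phi> (s [^] k) x \<in> A \<longrightarrow> s [^] k = \<one>)"

lemma wanderingD: "wandering s A \<Longrightarrow> x \<in> A \<Longrightarrow> \<phi> (s [^] (k::int)) x \<in> A \<Longrightarrow> s [^] k = \<one>"
  by (auto simp: wandering_def)

lemma action_closed: "g \<in> carrier G \<Longrightarrow> x \<in> E \<Longrightarrow> \<phi> g x \<in> E"
  using element_image by blast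

lemma action_one: "x \<in> E \<Longrightarrow> \<phi> \<one> x = x"
  by (metis id_eq_one restrict_apply')

lemma wanderingI_nat:
  assumes s: "s \<in> carrier G" and "A \<subseteq> E"
    and nat: "\<And>(n::nat) x. x \<in> A \<Longrightarrow> \<phi> (s [^] n) x \<in> A \<Longrightarrow> s [^] n = \<one>"
  shows "wandering s A"
  unfolding wandering_def
proof (intro allI ballI impI)
  fix k :: int and x
  assume x: "x \<in> A" "\<phi> (s [^] k) x \<in> A"
  show "s [^] k = \<one>"
  proof (cases k)
    case (nonneg n)
    then show ?thesis using nat[of x n] x by (simp add: int_pow_int)
  next
    case (neg n)
    define h where "h = s [^] Suc n"
    have h: "h \<in> carrier G" unfolding h_def using s by (rule nat_pow_closed)
    have k: "s [^] k = inv h" unfolding neg h_def by (rule int_pow_neg_int[OF s])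
    have "\<phi> h (\<phi> (inv h) x) = x"
      using orbit_sym_aux[of "inv h" x] h x(1) \<open>A \<subseteq> E\<close> by auto
    then have "h = \<one>"
      using nat[of "\<phi> (inv h) x" "Suc n"] x unfolding k h_def[symmetric] by simp
    then show ?thesis by (simp add: k)
  qed
qed

lemma wandering_conj:
  assumes g: "g \<in> carrier G" and s: "s \<in> carrier G" and "wandering s A"
    and "B \<subseteq> E" "\<phi> g ` B \<subseteq> A"
  shows "wandering (inv g \<otimes> s \<otimes> g) B"
  unfolding wandering_def
proof (intro allI ballI impI)
  fix k :: int and x
  let ?c = "inv g \<otimes> s \<otimes> g"
  assume x: "x \<in> B" "\<phi> (?c [^] k) x \<in> B"
  have ck: "?c [^] k = inv g \<otimes> s [^] k \<otimes> g" by (rule int_pow_conj[OF s g])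
  have "g \<otimes> ?c [^] k = s [^] k \<otimes> g"
    unfolding ck using g s by (simp add: m_assoc[symmetric])
  then have "\<phi> g (\<phi> (?c [^] k) x) = \<phi> (s [^] k) (\<phi> g x)"
    using composition_rule[of x g "?c [^] k"] composition_rule[of x "s [^] k" g] g s x assms(4)
    by auto
  moreover have "\<phi> g x \<in> A" "\<phi> g (\<phi> (?c [^] k) x) \<in> A"
    using assms(5) x by blast+
  ultimately have "s [^] k = \<one>" using wanderingD[OF \<open>wandering s A\<close>] by simp
  then show "?c [^] k = \<one>" unfolding ck using g by simp
qed

end

locale ping_pong = group_action G E \<phi> for G (structure) and E :: "'b set" and \<phi> +
  fixes S :: "'s set" and c :: "'s \<Rightarrow> 'a" and J :: "'s \<Rightarrow> 'b set" and p :: 'b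
  assumes element_closed: "s \<in> S \<Longrightarrow> c s \<in> carrier G"
    and disjoint: "disjoint_family_on J S"
    and wandering_complement: "s \<in> S \<Longrightarrow> wandering (c s) (E - J s)"
    and base_point: "p \<in> E" "s \<in> S \<Longrightarrow> p \<notin> J s"
begin

interpretation group G
  by (rule group_hom.axioms(1)[OF group_hom])

inductive_set reduced_orbit :: "'b set" where
  base: "p \<in> reduced_orbit"
| move: "\<phi> (c s [^] (k::int)) x \<in> reduced_orbit"
    if "x \<in> reduced_orbit" "s \<in> S" "x \<notin> J s" "c s [^] k \<noteq> \<one>"

lemma reduced_orbit_in_space: "x \<in> reduced_orbit \<Longrightarrow> x \<in> E"
  by (induction rule: reduced_orbit.induct) (auto intro: base_point action_closed element_closed)

lemma nontrivial_pow_into_target: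
  assumes "s \<in> S" "x \<in> E" "x \<notin> J s" "c s [^] (k::int) \<noteq> \<one>"
  shows "\<phi> (c s [^] k) x \<in> J s"
  using wanderingD[OF wandering_complement[OF assms(1)], of x k] assms
    element_closed[OF assms(1)] action_closed[of "c s [^] k" x]
  by auto

lemma reduced_orbit_subset_targets: "reduced_orbit \<subseteq> insert p (\<Union>s\<in>S. J s)"
proof
  fix x assume "x \<in> reduced_orbit"
  then show "x \<in> insert p (\<Union>s\<in>S. J s)"
    by cases (use nontrivial_pow_into_target reduced_orbit_in_space in blast)+
qed

lemma reduced_orbit_int_pow_closed:
  assumes x: "x \<in> reduced_orbit" and "s \<in> S"
  shows "\<phi> (c s [^] (k::int)) x \<in> reduced_orbit"
proof (cases "c s [^] k = \<one>")
  case True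
  then show ?thesis using action_one[OF reduced_orbit_in_space[OF x]] x by simp
next
  case False
  note move_x = reduced_orbit.move[OF x \<open>s \<in> S\<close> _ False]
  show ?thesis
    using x
  proof cases
    case base
    then show ?thesis using move_x base_point(2)[OF \<open>s \<in> S\<close>] by blast
  next
    case (move y t l)
    have y: "y \<in> E" by (rule reduced_orbit_in_space[OF move(2)])
    show ?thesis
    proof (cases "t = s")
      case True
      have "\<phi> (c s [^] k) x = \<phi> (c s [^] (k + l)) y"
        using element_closed[OF \<open>s \<in> S\<close>] y
        by (simp add: move(1) True composition_rule int_pow_mult)
      moreover have "\<phi> (c s [^] (k + l)) y \<in> reduced_orbit"
        using move(2-4) action_one[OF y] reduced_orbit.move[of y s "k + l"] True
        by (cases "c s [^] (k + l) = \<one>") simp_all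
      ultimately show ?thesis by simp
    next
      case False
      have "x \<in> J t" unfolding move(1) by (rule nontrivial_pow_into_target[OF move(3) y move(4,5)])
      then show ?thesis
        using move_x disjoint_family_onD[OF disjoint move(3) \<open>s \<in> S\<close> False] by blast
    qed
  qed
qed

lemma generate_orbit_base_point:
  assumes "g \<in> generate G (c ` S)"
  shows "\<phi> g p \<in> insert p (\<Union>s\<in>S. J s)"
proof -
  have "\<forall>x\<in>reduced_orbit. \<phi> g x \<in> reduced_orbit"
    using assms
  proof induction
    case one
    then show ?case using action_one reduced_orbit_in_space by simp
  next
    case (incl h)
    then obtain s where "s \<in> S" "h = c s" by blast
    then show ?case using reduced_orbit_int_pow_closed[of _ s 1] element_closed by simp
  next
    case (inv h)
    then obtain s where "s \<in> S" "h = c s" by blast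
    then show ?case
      using reduced_orbit_int_pow_closed[of _ s "- 1"] element_closed by (simp add: int_pow_neg)
  next
    case (eng g h)
    have "g \<in> carrier G" "h \<in> carrier G"
      using generate_in_carrier[of "c ` S"] eng.hyps element_closed by blast+
    then show ?case using eng.IH reduced_orbit_in_space by (simp add: composition_rule)
  qed
  then show ?thesis using reduced_orbit.base reduced_orbit_subset_targets by blast
qed

end

lemma (in group_action) not_invariably_generated_if_ping_pong:
  fixes J :: "nat \<Rightarrow> 'c set"
  assumes "countable (carrier G)" and J: "disjoint_family J"
    and conj: "\<And>s n. s \<in> carrier G \<Longrightarrow> \<exists>g\<in>carrier G. wandering (inv g \<otimes> s \<otimes> g) (E - J n)"
    and p: "p \<in> E" "\<And>n. p \<notin> J n"
    and h: "h \<in> carrier G" "\<phi> h p \<notin> insert p (\<Union>n. J n)"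
  shows "\<not> invariably_generated G"
proof
  interpret group G
    by (rule group_hom.axioms(1)[OF group_hom])
  assume "invariably_generated G"
  then obtain S where S: "S \<subseteq> carrier G" and gen: "\<And>g. g \<in> S \<rightarrow> carrier G \<Longrightarrow>
      generate G ((\<lambda>s. inv (g s) \<otimes> s \<otimes> g s) ` S) = carrier G"
    unfolding invariably_generated_def by blast
  define J' where "J' s = J (to_nat_on (carrier G) s)" for s
  have "\<forall>s\<in>S. \<exists>g\<in>carrier G. wandering (inv g \<otimes> s \<otimes> g) (E - J' s)"
    using conj S unfolding J'_def by blast
  then obtain g where g: "\<And>s. s \<in> S \<Longrightarrow> g s \<in> carrier G"
      "\<And>s. s \<in> S \<Longrightarrow> wandering (inv (g s) \<otimes> s \<otimes> g s) (E - J' s)"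
    by metis
  interpret ping_pong G E \<phi> S "\<lambda>s. inv (g s) \<otimes> s \<otimes> g s" J' p
  proof
    show "disjoint_family_on J' S"
    proof (unfold disjoint_family_on_def, intro ballI impI)
      fix s t assume "s \<in> S" "t \<in> S" "s \<noteq> t"
      then have "to_nat_on (carrier G) s \<noteq> to_nat_on (carrier G) t"
        using S inj_on_to_nat_on[OF assms(1)] by (auto dest: inj_onD)
      then show "J' s \<inter> J' t = {}"
        unfolding J'_def by (intro disjoint_family_onD[OF J]) simp_all
    qed
    show "inv (g s) \<otimes> s \<otimes> g s \<in> carrier G" if "s \<in> S" for s
      using g(1) S that by blast
  qed (use g(2) p in \<open>auto simp: J'_def\<close>)
  have "h \<in> generate G ((\<lambda>s. inv (g s) \<otimes> s \<otimes> g s) ` S)"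
    using gen[of g] g(1) h(1) by simp
  then have "\<phi> h p \<in> insert p (\<Union>s\<in>S. J' s)"
    by (rule generate_orbit_base_point)
  then show False using h(2) by (auto simp: J'_def)
qed

section \<open>Lifts of circle homeomorphisms\<close>

text \<open>HOL-Algebra reserves the notation \<open>inv\<close> for group inverses.\<close>

abbreviation inv_fun :: "('a \<Rightarrow> 'b) \<Rightarrow> 'b \<Rightarrow> 'a" where
  "inv_fun \<equiv> inv_into UNIV"

locale circle_lift =
  fixes F :: "real \<Rightarrow> real"
  assumes continuous: "continuous_on UNIV F"
    and strict_mono: "strict_mono F"
    and add_one: "F (x + 1) = F x + 1"
begin

lemma less_iff: "F x < F y \<longleftrightarrow> x < y"
  and le_iff: "F x \<le> F y \<longleftrightarrow> x \<le> y"
  and eq_iff: "F x = F y \<longleftrightarrow> x = y"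
  using strict_mono by (auto simp: strict_mono_less strict_mono_less_eq strict_mono_eq)

lemma tendsto_nhds: "(F \<longlongrightarrow> F x) (nhds x)"
  using continuous
  by (simp add: continuous_on_eq_continuous_at isCont_def tendsto_at_iff_tendsto_nhds)

lemma add_int: "F (x + of_int m) = F x + of_int m"
proof (induction m rule: int_induct[where k = 0])
  case (step1 m)
  then show ?case using add_one[of "x + of_int m"] by (simp add: add.assoc)
next
  case (step2 m)
  then show ?case using add_one[of "x + of_int (m - 1)"] by (simp add: add.assoc)
qed simp

lemma diff_int: "F (x - of_int m) = F x - of_int m"
  using add_int[of x "- m"] by simp

lemma frac_apply_frac: "frac (F (frac x)) = frac (F x)"
  by (simp add: diff_int frac_def)

lemma bij: "bij F"
proof (rule bijI)
  show "inj F" using strict_mono by (rule strict_mono_imp_inj_on)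
  have "\<exists>x\<ge>of_int \<lfloor>y - F 0\<rfloor>. x \<le> of_int (\<lfloor>y - F 0\<rfloor> + 1) \<and> F x = y" for y
  proof (rule IVT')
    have F_int: "F (of_int m) = F 0 + of_int m" for m
      using add_int[of 0] by simp
    show "F (of_int \<lfloor>y - F 0\<rfloor>) \<le> y" "y \<le> F (of_int (\<lfloor>y - F 0\<rfloor> + 1))"
      unfolding F_int by linarith+
  qed (use continuous in \<open>auto intro: continuous_on_subset\<close>)
  then show "surj F" by (metis surjI)
qed

lemma F_inv [simp]: "F (inv_fun F x) = x" and inv_F [simp]: "inv_fun F (F x) = x"
  using bij by (simp_all add: bij_is_surj surj_f_inv_f bij_is_inj)

end

lemma circle_lift_add: "circle_lift (\<lambda>x. x + r)"
  by standard (auto simp: strict_mono_def intro!: continuous_intros)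

lemma circle_lift_comp:
  assumes "circle_lift F" "circle_lift G"
  shows "circle_lift (F \<circ> G)"
proof -
  interpret F: circle_lift F by fact
  interpret G: circle_lift G by fact
  show ?thesis
  proof
    show "continuous_on UNIV (F \<circ> G)"
      using F.continuous G.continuous continuous_on_subset by (intro continuous_on_compose) blast+
    show "strict_mono (F \<circ> G)"
      by (simp add: strict_mono_def F.less_iff G.less_iff)
  qed (simp add: F.add_one G.add_one)
qed

lemma circle_lift_funpow: "circle_lift F \<Longrightarrow> circle_lift (F ^^ n)"
proof (induction n)
  case 0
  show ?case using circle_lift_add[of 0] by (simp add: id_def)
next
  case (Suc n)
  then show ?case using circle_lift_comp[of F "F ^^ n"] by (simp add: comp_def)
qed

lemma circle_lift_inv:
  assumes "circle_lift F"
  shows "circle_lift (inv_fun F)"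
proof -
  interpret circle_lift F by fact
  show ?thesis
  proof
    have "x < y \<Longrightarrow> inv_fun F x < inv_fun F y" for x y
      using less_iff[of "inv_fun F x" "inv_fun F y"] by simp
    then show "strict_mono (inv_fun F)" by (rule strict_monoI)
    then show "continuous_on UNIV (inv_fun F)"
      by (intro continuous_onI_mono)
         (simp_all add: bij_is_inj[OF bij] inj_imp_surj_inv strict_mono_mono monoD)
    show "inv_fun F (x + 1) = inv_fun F x + 1" for x
      using add_one[of "inv_fun F x"] by (metis F_inv inv_F)
  qed
qed

subsection \<open>Breakpoints\<close>

definition breakpoints :: "(real \<Rightarrow> real) \<Rightarrow> real set" where
  "breakpoints F = {x. \<nexists>k::int. \<forall>\<^sub>F y in nhds x. F y = F x + 2 powr of_int k * (y - x)}"

lemma not_breakpointI: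
  "\<forall>\<^sub>F y in nhds x. F y = F x + 2 powr of_int k * (y - x) \<Longrightarrow> x \<notin> breakpoints F"
  by (auto simp only: breakpoints_def mem_Collect_eq)

lemma not_breakpointE:
  assumes "x \<notin> breakpoints F"
  obtains k :: int where "\<forall>\<^sub>F y in nhds x. F y = F x + 2 powr of_int k * (y - x)"
  using assms by (auto simp: breakpoints_def)

lemma not_breakpoint_iff_ball: "x \<notin> breakpoints F \<longleftrightarrow>
    (\<exists>k::int. \<exists>e>0. \<forall>y. \<bar>y - x\<bar> < e \<longrightarrow> F y = F x + 2 powr of_int k * (y - x))"
  by (simp add: breakpoints_def eventually_nhds_metric dist_real_def)

lemma not_breakpoint_if_affine:
  assumes "a < x" "x < b" "\<And>y. a < y \<Longrightarrow> y < b \<Longrightarrow> F y = 2 powr of_int k * y + c"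
  shows "x \<notin> breakpoints F"
proof (rule not_breakpointI)
  have "\<forall>\<^sub>F y in nhds x. y \<in> {a<..<b}"
    using assms(1,2) by (intro eventually_nhds_in_open) simp_all
  then show "\<forall>\<^sub>F y in nhds x. F y = F x + 2 powr of_int k * (y - x)"
    by eventually_elim (use assms in \<open>simp add: algebra_simps\<close>)
qed

lemma breakpoints_add: "breakpoints (\<lambda>x. x + r) = {}"
  using not_breakpoint_if_affine[of "x - 1" x "x + 1" "\<lambda>x. x + r" 0 r for x] by auto

lemma breakpoints_comp_subset:
  assumes "circle_lift G"
  shows "breakpoints (F \<circ> G) \<subseteq> breakpoints G \<union> G -` breakpoints F"
proof (rule subsetI, rule ccontr)
  fix x assume x: "x \<in> breakpoints (F \<circ> G)" "x \<notin> breakpoints G \<union> G -` breakpoints F"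
  then obtain l :: int where l: "\<forall>\<^sub>F y in nhds x. G y = G x + 2 powr of_int l * (y - x)"
    by (auto elim: not_breakpointE)
  obtain k :: int where "\<forall>\<^sub>F y in nhds (G x). F y = F (G x) + 2 powr of_int k * (y - G x)"
    using x(2) by (auto elim: not_breakpointE)
  then have "\<forall>\<^sub>F y in nhds x. F (G y) = F (G x) + 2 powr of_int k * (G y - G x)"
    by (rule eventually_compose_filterlim) (rule circle_lift.tendsto_nhds[OF assms])
  with l have "\<forall>\<^sub>F y in nhds x. (F \<circ> G) y = (F \<circ> G) x + 2 powr of_int (k + l) * (y - x)"
    by eventually_elim (simp add: powr_add)
  then show False using x(1) not_breakpointI by blast
qed

context circle_lift
begin

lemma breakpoints_inv_subset: "breakpoints (inv_fun F) \<subseteq> F ` breakpoints F"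
proof
  fix y assume y: "y \<in> breakpoints (inv_fun F)"
  have "inv_fun F y \<in> breakpoints F"
  proof (rule ccontr)
    assume "inv_fun F y \<notin> breakpoints F"
    then obtain k :: int where
      k: "\<forall>\<^sub>F x in nhds (inv_fun F y). F x = F (inv_fun F y) + 2 powr of_int k * (x - inv_fun F y)"
      by (rule not_breakpointE)
    have "\<forall>\<^sub>F z in nhds y. z = y + 2 powr of_int k * (inv_fun F z - inv_fun F y)"
      using eventually_compose_filterlim[OF k circle_lift.tendsto_nhds[OF circle_lift_inv]]
        circle_lift_axioms by simp
    then have "\<forall>\<^sub>F z in nhds y. inv_fun F z = inv_fun F y + 2 powr of_int (- k) * (z - y)"
    proof eventually_elim
      case (elim z)
      then have "z - y = 2 powr of_int k * (inv_fun F z - inv_fun F y)" by simp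
      then show ?case by (simp add: powr_minus field_simps)
    qed
    then show False using y not_breakpointI by blast
  qed
  then show "y \<in> F ` breakpoints F" by (metis F_inv imageI)
qed

lemma breakpoint_add_int:
  assumes "x \<in> breakpoints F"
  shows "x + of_int m \<in> breakpoints F"
proof (rule ccontr)
  assume "x + of_int m \<notin> breakpoints F"
  then obtain k :: int where
    "\<forall>\<^sub>F y in nhds (x + of_int m). F y = F (x + of_int m) + 2 powr of_int k * (y - (x + of_int m))"
    by (rule not_breakpointE)
  then have "\<forall>\<^sub>F y in nhds x. F (y + of_int m) = F (x + of_int m) +
      2 powr of_int k * (y + of_int m - (x + of_int m))"
    by (rule eventually_compose_filterlim) (intro tendsto_intros filterlim_ident)
  then have "\<forall>\<^sub>F y in nhds x. F y = F x + 2 powr of_int k * (y - x)"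
    by eventually_elim (simp add: add_int)
  then show False using assms not_breakpointI by blast
qed

lemma breakpoint_frac: "x \<in> breakpoints F \<Longrightarrow> frac x \<in> breakpoints F"
  using breakpoint_add_int[of x "- \<lfloor>x\<rfloor>"] by (simp add: frac_def)

end

subsection \<open>Dyadic rationals\<close>

lemma dyadic_iff_Ints: "dyadic x \<longleftrightarrow> (\<exists>n. x * 2 ^ n \<in> \<int>)"
  by (auto simp: dyadic_def Ints_def eq_divide_eq)

lemma mult_power2_Ints_mono:
  fixes x :: real
  assumes "x * 2 ^ m \<in> \<int>" "m \<le> n"
  shows "x * 2 ^ n \<in> \<int>"
proof -
  have "x * 2 ^ m * 2 ^ (n - m) \<in> \<int>" using assms(1) by simp
  then show ?thesis using assms(2) by (simp add: mult.assoc flip: power_add)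
qed

lemma eventually_dyadic_denominator:
  assumes "dyadic x"
  shows "\<forall>\<^sub>F n in sequentially. x * 2 ^ n \<in> \<int>"
  using assms mult_power2_Ints_mono unfolding dyadic_iff_Ints eventually_sequentially by blast

lemma dyadic_int [simp]: "x \<in> \<int> \<Longrightarrow> dyadic x"
  unfolding dyadic_iff_Ints by (intro exI[of _ 0]) simp

lemma dyadic_inverse_power2 [simp]: "dyadic (1 / 2 ^ n)"
  unfolding dyadic_iff_Ints by (intro exI[of _ n]) simp

lemma dyadic_add: "dyadic x \<Longrightarrow> dyadic y \<Longrightarrow> dyadic (x + y)"
proof -
  assume "dyadic x" "dyadic y"
  then have "\<forall>\<^sub>F n in sequentially. x * 2 ^ n \<in> \<int> \<and> y * 2 ^ n \<in> \<int>"
    by (intro eventually_conj eventually_dyadic_denominator)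
  then obtain n where "x * 2 ^ n \<in> \<int>" "y * 2 ^ n \<in> \<int>"
    unfolding eventually_sequentially by blast
  then have "(x + y) * 2 ^ n \<in> \<int>" by (simp add: distrib_right)
  then show ?thesis unfolding dyadic_iff_Ints ..
qed

lemma dyadic_minus_iff [simp]: "dyadic (- x) \<longleftrightarrow> dyadic x"
  by (simp add: dyadic_iff_Ints)

lemma dyadic_add_iff: "dyadic y \<Longrightarrow> dyadic (x + y) \<longleftrightarrow> dyadic x"
  using dyadic_add[of "x + y" "- y"] dyadic_add[of x y] by auto

lemma dyadic_double_iff: "dyadic (2 * x) \<longleftrightarrow> dyadic x"
proof
  assume "dyadic (2 * x)"
  then obtain n where "2 * x * 2 ^ n \<in> \<int>" by (auto simp: dyadic_iff_Ints)
  then have "x * 2 ^ Suc n \<in> \<int>" by (simp add: algebra_simps)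
  then show "dyadic x" unfolding dyadic_iff_Ints by blast
qed (use dyadic_add[of x x] in simp)

lemma dyadic_imp_Rats: "dyadic x \<Longrightarrow> x \<in> \<rat>"
  by (auto simp: dyadic_def)

subsection \<open>Lifts of elements of Thompson's group\<close>

lemma thompson_lift_iff_unit_interval: "thompson_lift F \<longleftrightarrow>
    circle_lift F \<and> (\<forall>x. dyadic (F x) \<longleftrightarrow> dyadic x) \<and>
    (\<exists>B. finite B \<and> (\<forall>b\<in>B. dyadic b) \<and> (\<forall>x\<in>{0..1} - B. x \<notin> breakpoints F))"
  unfolding thompson_lift_def circle_lift_def not_breakpoint_iff_ball by auto

lemma (in circle_lift)
  assumes B: "finite B" "\<forall>b\<in>B. dyadic b" "\<forall>x\<in>{0..1} - B. x \<notin> breakpoints F"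
  shows breakpoint_dyadic: "x \<in> breakpoints F \<Longrightarrow> dyadic x"
    and finite_breakpoints: "finite (breakpoints F \<inter> {a..b})"
proof -
  have frac: "frac x \<in> B" if "x \<in> breakpoints F" for x
    using breakpoint_frac[OF that] frac_lt_1[of x] B(3) by (force simp: less_imp_le)
  show "dyadic x" if "x \<in> breakpoints F"
  proof -
    have "dyadic (frac x + of_int \<lfloor>x\<rfloor>)"
      using frac[OF that] B(2) by (intro dyadic_add) simp_all
    then show ?thesis by (simp add: frac_def)
  qed
  have "breakpoints F \<inter> {a..b} \<subseteq> (\<lambda>(m, x). of_int m + x) ` ({\<lfloor>a\<rfloor>..\<lfloor>b\<rfloor>} \<times> B)"
  proof
    fix x assume "x \<in> breakpoints F \<inter> {a..b}"
    then show "x \<in> (\<lambda>(m, x). of_int m + x) ` ({\<lfloor>a\<rfloor>..\<lfloor>b\<rfloor>} \<times> B)"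
      using frac by (intro image_eqI[of _ _ "(\<lfloor>x\<rfloor>, frac x)"]) (auto simp: frac_def floor_mono)
  qed
  then show "finite (breakpoints F \<inter> {a..b})"
    by (rule finite_subset) (simp add: \<open>finite B\<close>)
qed

lemma thompson_lift_iff: "thompson_lift F \<longleftrightarrow>
    circle_lift F \<and> (\<forall>x. dyadic (F x) \<longleftrightarrow> dyadic x) \<and>
    (\<forall>x\<in>breakpoints F. dyadic x) \<and> (\<forall>a b. finite (breakpoints F \<inter> {a..b}))"
  (is "_ \<longleftrightarrow> ?R")
proof
  assume "thompson_lift F"
  then obtain B where F: "circle_lift F" "\<forall>x. dyadic (F x) \<longleftrightarrow> dyadic x"
    and B: "finite B" "\<forall>b\<in>B. dyadic b" "\<forall>x\<in>{0..1} - B. x \<notin> breakpoints F"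
    unfolding thompson_lift_iff_unit_interval by blast
  show ?R
    using F circle_lift.breakpoint_dyadic[OF F(1) B] circle_lift.finite_breakpoints[OF F(1) B]
    by simp
next
  assume ?R
  then show "thompson_lift F"
    unfolding thompson_lift_iff_unit_interval by (auto intro: exI[of _ "breakpoints F \<inter> {0..1}"])
qed

lemma thompson_lift_circle_lift: "thompson_lift F \<Longrightarrow> circle_lift F"
  and thompson_lift_dyadic_iff: "thompson_lift F \<Longrightarrow> dyadic (F x) \<longleftrightarrow> dyadic x"
  and thompson_lift_breakpoint_dyadic: "thompson_lift F \<Longrightarrow> x \<in> breakpoints F \<Longrightarrow> dyadic x"
  and thompson_lift_finite_breakpoints: "thompson_lift F \<Longrightarrow> finite (breakpoints F \<inter> {a..b})"
  by (auto simp: thompson_lift_iff)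

lemma thompson_lift_add: "dyadic r \<Longrightarrow> thompson_lift (\<lambda>x. x + r)"
  by (simp add: thompson_lift_iff circle_lift_add breakpoints_add dyadic_add_iff)

lemma thompson_lift_comp:
  assumes "thompson_lift F" "thompson_lift G"
  shows "thompson_lift (F \<circ> G)"
proof -
  interpret G: circle_lift G by (rule thompson_lift_circle_lift[OF assms(2)])
  note subset = breakpoints_comp_subset[OF G.circle_lift_axioms, of F]
  have "finite (breakpoints (F \<circ> G) \<inter> {a..b})" for a b
  proof (rule finite_subset)
    show "breakpoints (F \<circ> G) \<inter> {a..b} \<subseteq>
        (breakpoints G \<inter> {a..b}) \<union> G -` (breakpoints F \<inter> {G a..G b})"
      using subset by (auto simp: G.le_iff)
    show "finite ((breakpoints G \<inter> {a..b}) \<union> G -` (breakpoints F \<inter> {G a..G b}))"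
      using assms
      by (intro finite_UnI finite_vimageI thompson_lift_finite_breakpoints bij_is_inj[OF G.bij])
  qed
  moreover have "dyadic x" if "x \<in> breakpoints (F \<circ> G)" for x
    using that subset assms thompson_lift_breakpoint_dyadic thompson_lift_dyadic_iff by blast
  ultimately show ?thesis
    using assms by (simp add: thompson_lift_iff circle_lift_comp)
qed

lemma thompson_lift_funpow:
  assumes "thompson_lift F"
  shows "thompson_lift (F ^^ n)"
proof (induction n)
  case 0
  show ?case using thompson_lift_add[of 0] by (simp add: id_def)
next
  case (Suc n)
  then show ?case using thompson_lift_comp[OF assms] by (simp add: comp_def)
qed

lemma thompson_lift_inv:
  assumes "thompson_lift F"
  shows "thompson_lift (inv_fun F)"
proof -
  interpret circle_lift F by (rule thompson_lift_circle_lift[OF assms])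
  have "finite (breakpoints (inv_fun F) \<inter> {a..b})" for a b
  proof (rule finite_subset)
    show "breakpoints (inv_fun F) \<inter> {a..b} \<subseteq> F ` (breakpoints F \<inter> {inv_fun F a..inv_fun F b})"
    proof
      fix y assume y: "y \<in> breakpoints (inv_fun F) \<inter> {a..b}"
      then obtain x where "x \<in> breakpoints F" "y = F x" using breakpoints_inv_subset by blast
      then show "y \<in> F ` (breakpoints F \<inter> {inv_fun F a..inv_fun F b})"
        using y le_iff[of "inv_fun F a" x] le_iff[of x "inv_fun F b"] by auto
    qed
  qed (use assms in \<open>intro finite_imageI thompson_lift_finite_breakpoints\<close>)
  moreover have "dyadic y" if "y \<in> breakpoints (inv_fun F)" for y
    using that breakpoints_inv_subset thompson_lift_breakpoint_dyadic[OF assms]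
      thompson_lift_dyadic_iff[OF assms] by blast
  moreover have "dyadic (inv_fun F x) \<longleftrightarrow> dyadic x" for x
    using thompson_lift_dyadic_iff[OF assms, of "inv_fun F x"] by simp
  ultimately show ?thesis
    by (simp add: thompson_lift_iff circle_lift_inv[OF circle_lift_axioms])
qed

section \<open>Standard dyadic intervals\<close>

definition std_dyadic :: "nat \<Rightarrow> real \<Rightarrow> real \<Rightarrow> bool" where
  "std_dyadic d a b \<longleftrightarrow> a * 2 ^ d \<in> \<int> \<and> b = a + 1 / 2 ^ d"

lemma std_dyadic_less: "std_dyadic d a b \<Longrightarrow> a < b"
  by (simp add: std_dyadic_def)

lemma std_dyadic_length_le: "std_dyadic d a b \<Longrightarrow> b \<le> a + 1"
  by (simp add: std_dyadic_def)

lemma std_dyadic_imp_dyadic: "std_dyadic d a b \<Longrightarrow> dyadic a"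
  by (auto simp: std_dyadic_def dyadic_iff_Ints)

lemma std_dyadic_add_Ints_iff:
  assumes "m \<in> \<int>"
  shows "std_dyadic d (a + m) (b + m) \<longleftrightarrow> std_dyadic d a b"
proof -
  have "(a + m) * 2 ^ d \<in> \<int> \<longleftrightarrow> a * 2 ^ d \<in> \<int>"
    using assms by (simp add: distrib_right)
  then show ?thesis by (auto simp: std_dyadic_def)
qed

lemma std_dyadic_end_le:
  assumes "std_dyadic d a b" "std_dyadic e u v" "d \<le> e" "u < b"
  shows "v \<le> b"
proof -
  have "b * 2 ^ d \<in> \<int>" using assms(1) by (auto simp: std_dyadic_def distrib_right)
  then have "b * 2 ^ e \<in> \<int>" by (rule mult_power2_Ints_mono[OF _ assms(3)])
  moreover have "u * 2 ^ e \<in> \<int>" using assms(2) by (simp add: std_dyadic_def)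
  ultimately obtain i j :: int where ij: "b * 2 ^ e = of_int i" "u * 2 ^ e = of_int j"
    by (elim Ints_cases)
  have "u * 2 ^ e < b * 2 ^ e" using assms(4) by simp
  then have "u * 2 ^ e + 1 \<le> b * 2 ^ e" unfolding ij by simp
  also have "u * 2 ^ e + 1 = v * 2 ^ e" using assms(2) by (simp add: std_dyadic_def distrib_right)
  finally show ?thesis by simp
qed

lemma std_dyadic_cover:
  obtains a b where "std_dyadic d a b" "a \<le> x" "x < b"
proof
  show "std_dyadic d (\<lfloor>x * 2 ^ d\<rfloor> / 2 ^ d) (\<lfloor>x * 2 ^ d\<rfloor> / 2 ^ d + 1 / 2 ^ d)"
    by (simp add: std_dyadic_def)
  show "\<lfloor>x * 2 ^ d\<rfloor> / 2 ^ d \<le> x" by (simp add: divide_le_eq)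
  have "x * 2 ^ d < \<lfloor>x * 2 ^ d\<rfloor> + 1" by linarith
  then show "x < \<lfloor>x * 2 ^ d\<rfloor> / 2 ^ d + 1 / 2 ^ d"
    by (simp add: field_simps)
qed

lemma finite_std_dyadic: "finite {(a, b). std_dyadic d a b \<and> p \<le> a \<and> a \<le> q}"
proof (rule finite_subset)
  show "{(a, b). std_dyadic d a b \<and> p \<le> a \<and> a \<le> q} \<subseteq>
      (\<lambda>i. (i / 2 ^ d, i / 2 ^ d + 1 / 2 ^ d)) ` {i \<in> \<int>. p * 2 ^ d \<le> i \<and> i \<le> q * 2 ^ d}"
    by (auto simp: std_dyadic_def intro!: image_eqI[of _ _ "_ * 2 ^ d"])
qed (intro finite_imageI finite_int_segment)

lemma not_breakpoint_derivative:
  assumes "x \<notin> breakpoints F"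
  obtains k :: int where "\<forall>\<^sub>F y in nhds x. (F has_real_derivative 2 powr of_int k) (at y)"
proof -
  obtain k :: int where "\<forall>\<^sub>F y in nhds x. F y = F x + 2 powr of_int k * (y - x)"
    using assms by (rule not_breakpointE)
  then have "\<forall>\<^sub>F y in nhds x. \<forall>\<^sub>F z in nhds y. F z = F x + 2 powr of_int k * (z - x)"
    by (simp add: eventually_eventually)
  then have "\<forall>\<^sub>F y in nhds x. (F has_real_derivative 2 powr of_int k) (at y)"
  proof eventually_elim
    case (elim y)
    show ?case
      by (subst DERIV_cong_ev[OF refl elim refl]) (auto intro!: derivative_eq_intros)
  qed
  then show ?thesis by (rule that)
qed

definition pow2_affine_on :: "real \<Rightarrow> real \<Rightarrow> (real \<Rightarrow> real) \<Rightarrow> bool" where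
  "pow2_affine_on a b F \<longleftrightarrow> (\<exists>k::int. \<forall>x\<in>{a..b}. F x = F a + 2 powr of_int k * (x - a))"

lemma pow2_affine_on_if_no_breakpoints:
  assumes "a < b" "continuous_on {a..b} F" "breakpoints F \<inter> {a<..<b} = {}"
  shows "pow2_affine_on a b F"
proof -
  have "\<exists>k::int. \<forall>\<^sub>F y in nhds x. (F has_real_derivative 2 powr of_int k) (at y)"
    if "x \<in> {a<..<b}" for x
    using assms(3) that by (metis disjoint_iff not_breakpoint_derivative)
  then obtain k :: "real \<Rightarrow> int" where
    k: "\<And>x. x \<in> {a<..<b} \<Longrightarrow>
      \<forall>\<^sub>F y in nhds x. (F has_real_derivative 2 powr of_int (k x)) (at y)"
    by metis
  note deriv = eventually_nhds_x_imp_x[OF k]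
  define c where "c = (a + b) / 2"
  have c: "c \<in> {a<..<b}" using \<open>a < b\<close> by (simp add: c_def field_simps)
  have slope: "(2::real) powr of_int (k c) = 2 powr of_int (k x)" if x: "x \<in> {a<..<b}" for x
  proof (rule connected_local_const[OF connected_Ioo c x], rule ballI)
    fix y assume y: "y \<in> {a<..<b}"
    show "\<forall>\<^sub>F z in at y within {a<..<b}. (2::real) powr of_int (k y) = 2 powr of_int (k z)"
      unfolding eventually_at_filter using k[OF y]
      by eventually_elim (blast intro: DERIV_unique deriv)
  qed
  have "F x - 2 powr of_int (k c) * (x - a) = F a - 2 powr of_int (k c) * (a - a)"
    if "x \<in> {a..b}" for x
  proof (rule DERIV_isconst2[OF \<open>a < b\<close>])
    show "continuous_on {a..b} (\<lambda>x. F x - 2 powr of_int (k c) * (x - a))"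
      by (intro continuous_intros assms(2))
    show "((\<lambda>x. F x - 2 powr of_int (k c) * (x - a)) has_real_derivative 0) (at y)"
      if "a < y" "y < b" for y
      using deriv[of y] slope[of y] that by (auto intro!: derivative_eq_intros)
  qed (use that in auto)
  then show ?thesis
    unfolding pow2_affine_on_def by (intro exI[of _ "k c"]) (simp add: algebra_simps)
qed

definition maps_std_dyadic :: "nat \<Rightarrow> (real \<Rightarrow> real) \<Rightarrow> real set \<Rightarrow> bool" where
  "maps_std_dyadic n F A \<longleftrightarrow> (\<forall>d\<ge>n. \<forall>a b. std_dyadic d a b \<longrightarrow> {a..b} \<subseteq> A \<longrightarrow>
     (\<exists>e. std_dyadic e (F a) (F b) \<and> d \<le> e + n))"

lemma std_dyadic_affine_image:
  fixes k :: int
  assumes affine: "\<And>x. x \<in> {u..v} \<Longrightarrow> F x = F u + 2 powr of_int k * (x - u)"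
    and "u * 2 ^ d \<in> \<int>" "F u * 2 ^ e \<in> \<int>" and e: "int e = int d - k"
    and ab: "std_dyadic d a b" "{a..b} \<subseteq> {u..v}"
  shows "std_dyadic e (F a) (F b)"
proof -
  have "a < b" by (rule std_dyadic_less[OF ab(1)])
  then have F: "F a = F u + 2 powr of_int k * (a - u)" "F b - F a = 2 powr of_int k * (b - a)"
    using affine[of a] affine[of b] ab(2) by (simp_all add: algebra_simps)
  have "real_of_int k = real d - real e" using e by linarith
  then have scale: "2 powr of_int k * 2 ^ e = (2::real) ^ d"
    by (simp add: powr_diff powr_realpow)
  have "F a * 2 ^ e = F u * 2 ^ e + (a - u) * 2 ^ d"
    using F(1) by (simp only: distrib_left mult_ac flip: scale)
  moreover have "(a - u) * 2 ^ d \<in> \<int>"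
    using ab(1) assms(2) by (simp add: std_dyadic_def left_diff_distrib)
  ultimately have "F a * 2 ^ e \<in> \<int>" using assms(3) by simp
  moreover have "F b - F a = 1 / 2 ^ e"
    unfolding F(2) using ab(1) scale by (simp add: std_dyadic_def field_simps)
  ultimately show ?thesis by (simp add: std_dyadic_def)
qed

lemma eventually_maps_std_dyadic_if_affine:
  assumes "pow2_affine_on u v F" "dyadic u" "dyadic (F u)"
  shows "\<forall>\<^sub>F n in sequentially. maps_std_dyadic n F {u..v}"
proof -
  obtain k :: int where affine: "\<And>x. x \<in> {u..v} \<Longrightarrow> F x = F u + 2 powr of_int k * (x - u)"
    using assms(1) unfolding pow2_affine_on_def by blast
  obtain l m where l: "u * 2 ^ l \<in> \<int>" and m: "F u * 2 ^ m \<in> \<int>"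
    using assms(2,3) by (auto simp: dyadic_iff_Ints)
  have "\<exists>e. std_dyadic e (F a) (F b) \<and> d \<le> e + n"
    if n: "max l (m + nat \<bar>k\<bar>) \<le> n" "n \<le> d" and ab: "std_dyadic d a b" "{a..b} \<subseteq> {u..v}"
    for n d a b
  proof (intro exI conjI)
    define e where "e = nat (int d - k)"
    have e: "int e = int d - k" using n unfolding e_def by linarith
    show "d \<le> e + n" using e n by linarith
    show "std_dyadic e (F a) (F b)"
    proof (rule std_dyadic_affine_image[OF affine _ _ e ab])
      show "u * 2 ^ d \<in> \<int>" by (rule mult_power2_Ints_mono[OF l]) (use n in simp)
      show "F u * 2 ^ e \<in> \<int>" by (rule mult_power2_Ints_mono[OF m]) (use e n in linarith)
    qed
  qed
  then show ?thesis
    unfolding maps_std_dyadic_def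
    by (intro eventually_sequentiallyI[of "max l (m + nat \<bar>k\<bar>)"]) blast
qed

lemma thompson_lift_affine_on_std_dyadic:
  assumes "thompson_lift F"
  obtains N where "\<And>a b. std_dyadic N a b \<Longrightarrow> pow2_affine_on a b F"
proof -
  interpret circle_lift F by (rule thompson_lift_circle_lift[OF assms])
  have "\<forall>\<^sub>F n in sequentially. \<forall>x\<in>breakpoints F \<inter> {0..1}. x * 2 ^ n \<in> \<int>"
    using assms
    by (intro eventually_ball_finite ballI eventually_dyadic_denominator)
       (auto simp: thompson_lift_finite_breakpoints thompson_lift_breakpoint_dyadic)
  then obtain N where N: "\<And>x. x \<in> breakpoints F \<inter> {0..1} \<Longrightarrow> x * 2 ^ N \<in> \<int>"
    unfolding eventually_sequentially by blast
  have "pow2_affine_on a b F" if ab: "std_dyadic N a b" for a b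
  proof (rule pow2_affine_on_if_no_breakpoints)
    show "a < b" using ab by (rule std_dyadic_less)
    show "continuous_on {a..b} F" using continuous continuous_on_subset by blast
    show "breakpoints F \<inter> {a<..<b} = {}"
    proof safe
      fix x assume "x \<in> breakpoints F" "x \<in> {a<..<b}"
      then have "frac x * 2 ^ N \<in> \<int>"
        using N breakpoint_frac frac_lt_1[of x] by (simp add: less_imp_le)
      then have "x * 2 ^ N \<in> \<int>"
        by (simp add: frac_def left_diff_distrib)
      moreover have "a * 2 ^ N \<in> \<int>" using ab by (simp add: std_dyadic_def)
      moreover have "a * 2 ^ N < x * 2 ^ N" "x * 2 ^ N < b * 2 ^ N"
        using \<open>x \<in> {a<..<b}\<close> by simp_all
      moreover have "b * 2 ^ N = a * 2 ^ N + 1"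
        using ab by (simp add: std_dyadic_def distrib_right)
      ultimately show "x \<in> {}" using Ints_eq_abs_less1[of "x * 2 ^ N" "a * 2 ^ N"] by simp
    qed
  qed
  then show ?thesis using that by blast
qed

lemma (in circle_lift) maps_std_dyadic_UNIV:
  assumes "M \<le> N"
    and N: "\<And>u v. std_dyadic M u v \<Longrightarrow> - 1 \<le> u \<Longrightarrow> u \<le> 1 \<Longrightarrow> maps_std_dyadic N F {u..v}"
  shows "maps_std_dyadic N F UNIV"
  unfolding maps_std_dyadic_def
proof (intro allI impI)
  fix d a b assume d: "N \<le> d" and ab: "std_dyadic d a b"
  obtain u v where uv: "std_dyadic M u v" "u \<le> frac a" "frac a < v"
    by (rule std_dyadic_cover)
  have "- 1 \<le> u" "u \<le> 1"
    using uv(2,3) frac_ge_0[of a] frac_lt_1[of a] std_dyadic_length_le[OF uv(1)] by linarith+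
  with uv(1) have "maps_std_dyadic N F {u..v}" by (rule N)
  moreover have ab': "std_dyadic d (a - \<lfloor>a\<rfloor>) (b - \<lfloor>a\<rfloor>)"
    using std_dyadic_add_Ints_iff[of "- of_int \<lfloor>a\<rfloor>" d a b] ab by simp
  moreover have "{a - \<lfloor>a\<rfloor>..b - \<lfloor>a\<rfloor>} \<subseteq> {u..v}"
    using std_dyadic_end_le[OF uv(1) ab'] uv \<open>M \<le> N\<close> d by (simp add: frac_def)
  ultimately obtain e where "std_dyadic e (F (a - \<lfloor>a\<rfloor>)) (F (b - \<lfloor>a\<rfloor>))" "d \<le> e + N"
    using d unfolding maps_std_dyadic_def by blast
  then show "\<exists>e. std_dyadic e (F a) (F b) \<and> d \<le> e + N"
    using std_dyadic_add_Ints_iff[of "- of_int \<lfloor>a\<rfloor>" e "F a" "F b"] by (auto simp: diff_int)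
qed

lemma thompson_lift_maps_std_dyadic:
  assumes F: "thompson_lift F"
  obtains N where "maps_std_dyadic N F UNIV"
proof -
  obtain M where M: "\<And>u v. std_dyadic M u v \<Longrightarrow> pow2_affine_on u v F"
    using thompson_lift_affine_on_std_dyadic[OF F] by blast
  define cells where "cells = {(u, v). std_dyadic M u v \<and> - 1 \<le> u \<and> u \<le> 1}"
  have "\<forall>\<^sub>F n in sequentially. M \<le> n \<and> (\<forall>(u, v)\<in>cells. maps_std_dyadic n F {u..v})"
  proof (intro eventually_conj eventually_ge_at_top eventually_ball_finite)
    show "finite cells" unfolding cells_def by (rule finite_std_dyadic)
    show "\<forall>c\<in>cells. \<forall>\<^sub>F n in sequentially. case c of (u, v) \<Rightarrow> maps_std_dyadic n F {u..v}"
    proof safe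
      fix u v assume "(u, v) \<in> cells"
      then have uv: "std_dyadic M u v" by (simp add: cells_def)
      then have "pow2_affine_on u v F" by (rule M)
      then show "\<forall>\<^sub>F n in sequentially. maps_std_dyadic n F {u..v}"
      proof (rule eventually_maps_std_dyadic_if_affine)
        show "dyadic u" by (rule std_dyadic_imp_dyadic[OF uv])
        then show "dyadic (F u)" by (simp add: thompson_lift_dyadic_iff[OF F])
      qed
    qed
  qed
  then obtain N where "M \<le> N" "\<And>u v. (u, v) \<in> cells \<Longrightarrow> maps_std_dyadic N F {u..v}"
    unfolding eventually_sequentially by blast
  then have "maps_std_dyadic N F UNIV"
    by (intro circle_lift.maps_std_dyadic_UNIV[OF thompson_lift_circle_lift[OF F]])
       (auto simp: cells_def)
  then show ?thesis by (rule that)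
qed

subsection \<open>Countability of Thompson's group\<close>

definition piecewise_affine :: "nat \<Rightarrow> (real \<times> int) list \<Rightarrow> real \<Rightarrow> real" where
  "piecewise_affine N cs x =
     (let i = nat \<lfloor>x * 2 ^ N\<rfloor>; (c, k) = cs ! i in c + 2 powr of_int k * (x - i / 2 ^ N))"

lemma thompson_lift_piecewise_affine:
  assumes F: "thompson_lift F"
  shows "\<exists>N. \<exists>cs\<in>lists (\<rat> \<times> UNIV). \<forall>x. F (frac x) = piecewise_affine N cs (frac x)"
proof -
  obtain N where N: "\<And>u v. std_dyadic N u v \<Longrightarrow> pow2_affine_on u v F"
    using thompson_lift_affine_on_std_dyadic[OF F] by blast
  have cell: "std_dyadic N (real i / 2 ^ N) (real i / 2 ^ N + 1 / 2 ^ N)" for i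
    by (simp add: std_dyadic_def)
  from N[OF cell, unfolded pow2_affine_on_def] obtain k :: "nat \<Rightarrow> int" where k:
    "\<And>i x. x \<in> {real i / 2 ^ N..real i / 2 ^ N + 1 / 2 ^ N} \<Longrightarrow>
      F x = F (real i / 2 ^ N) + 2 powr of_int (k i) * (x - real i / 2 ^ N)"
    by metis
  define cs where "cs = map (\<lambda>i. (F (real i / 2 ^ N), k i)) [0..<2 ^ N]"
  have "F (frac x) = piecewise_affine N cs (frac x)" for x
  proof -
    define i where "i = nat \<lfloor>frac x * 2 ^ N\<rfloor>"
    have i: "real i \<le> frac x * 2 ^ N" "frac x * 2 ^ N < real i + 1"
      by (simp_all add: i_def)
    have "frac x * 2 ^ N < 2 ^ N" using frac_lt_1[of x] by simp
    then have "i < 2 ^ N"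
      using i(1) by (metis le_less_trans of_nat_less_numeral_power_cancel_iff)
    then have "cs ! i = (F (real i / 2 ^ N), k i)" by (simp add: cs_def)
    moreover have "frac x \<in> {real i / 2 ^ N..real i / 2 ^ N + 1 / 2 ^ N}"
      using i by (simp add: field_simps)
    ultimately show ?thesis using k by (simp add: piecewise_affine_def i_def[symmetric])
  qed
  moreover have "dyadic (F (real i / 2 ^ N))" for i
    using thompson_lift_dyadic_iff[OF F] std_dyadic_imp_dyadic[OF cell] by simp
  then have "cs \<in> lists (\<rat> \<times> UNIV)"
    by (auto simp: cs_def dyadic_imp_Rats)
  ultimately show ?thesis by blast
qed

lemma countable_thompson_T_set: "countable thompson_T_set"
proof (rule countable_subset)
  show "thompson_T_set \<subseteq>
      (\<lambda>(N, cs) x. frac (piecewise_affine N cs (frac x))) ` (UNIV \<times> lists (\<rat> \<times> UNIV))"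
  proof
    fix f assume "f \<in> thompson_T_set"
    then obtain F where F: "thompson_lift F" and f: "f = (\<lambda>x. frac (F x))"
      by (auto simp: thompson_T_set_def)
    obtain N cs where cs: "cs \<in> lists (\<rat> \<times> UNIV)"
      and eq: "\<forall>x. F (frac x) = piecewise_affine N cs (frac x)"
      using thompson_lift_piecewise_affine[OF F] by blast
    have "f = (\<lambda>x. frac (piecewise_affine N cs (frac x)))"
      using circle_lift.frac_apply_frac[OF thompson_lift_circle_lift[OF F]]
      by (simp add: f flip: eq)
    with cs show "f \<in> (\<lambda>(N, cs) x. frac (piecewise_affine N cs (frac x))) `
        (UNIV \<times> lists (\<rat> \<times> UNIV))"
      by auto
  qed
  show "countable ((\<lambda>(N, cs) x. frac (piecewise_affine N cs (frac x))) `
      (UNIV \<times> lists (\<rat> \<times> UNIV)))"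
    by (intro countable_image countable_SIGMA countable_lists countableI_type countable_rat)
qed

section \<open>Periodic points\<close>

lemma dyadic_bisection:
  assumes trans: "\<And>a b c. P a b \<Longrightarrow> P b c \<Longrightarrow> P a c" and "\<not> P 0 1"
  obtains L R where "\<And>d. std_dyadic d (L d) (R d)" "incseq L" "decseq R" "\<And>d. \<not> P (L d) (R d)"
proof -
  have "\<exists>I. \<forall>d. (case I d of (a, b) \<Rightarrow> std_dyadic d a b \<and> \<not> P a b) \<and>
      fst (I d) \<le> fst (I (Suc d)) \<and> snd (I (Suc d)) \<le> snd (I d)"
  proof (rule dependent_nat_choice)
    show "\<exists>I. case I of (a, b) \<Rightarrow> std_dyadic 0 a b \<and> \<not> P a b"
      using assms(2) by (intro exI[of _ "(0, 1)"]) (simp add: std_dyadic_def)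
  next
    fix I and d :: nat assume I: "case I of (a, b) \<Rightarrow> std_dyadic d a b \<and> \<not> P a b"
    define a b where "a = fst I" and "b = snd I"
    define c where "c = a + 1 / 2 ^ Suc d"
    have ab: "std_dyadic d a b" "\<not> P a b" using I by (simp_all add: a_def b_def split_beta)
    have "a * 2 ^ Suc d \<in> \<int>"
      using ab(1) mult_power2_Ints_mono[of a d "Suc d"] by (simp add: std_dyadic_def)
    moreover have "c * 2 ^ Suc d = a * 2 ^ Suc d + 1" by (simp add: c_def distrib_right)
    moreover have "b = c + 1 / 2 ^ Suc d" using ab(1) by (simp add: c_def std_dyadic_def)
    ultimately have halves: "std_dyadic (Suc d) a c" "std_dyadic (Suc d) c b"
      by (simp_all only: std_dyadic_def c_def[symmetric] Ints_add Ints_1)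
    then have "a \<le> c" "c \<le> b" by (auto dest: std_dyadic_less)
    moreover consider "\<not> P a c" | "\<not> P c b" using trans ab(2) by blast
    ultimately have "\<exists>a' b'. std_dyadic (Suc d) a' b' \<and> \<not> P a' b' \<and> a \<le> a' \<and> b' \<le> b"
      using halves by cases blast+
    then show "\<exists>J. (case J of (a, b) \<Rightarrow> std_dyadic (Suc d) a b \<and> \<not> P a b) \<and>
        fst I \<le> fst J \<and> snd J \<le> snd I"
      by (simp add: a_def b_def)
  qed
  then obtain I where I: "\<And>d. std_dyadic d (fst (I d)) (snd (I d)) \<and> \<not> P (fst (I d)) (snd (I d))"
    "\<And>d. fst (I d) \<le> fst (I (Suc d)) \<and> snd (I (Suc d)) \<le> snd (I d)"
    by (auto simp: split_beta)
  show ?thesis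
    by (rule that[of "\<lambda>d. fst (I d)" "\<lambda>d. snd (I d)"]) (simp_all add: I incseq_SucI decseq_SucI)
qed

lemma std_dyadic_frequently_bounded_level:
  assumes e: "\<And>n. std_dyadic (e n) (a n) (b n)" and "\<not> (\<lambda>n. b n - a n) \<longlonglongrightarrow> 0"
  obtains D where "\<exists>\<^sub>F n in sequentially. e n \<le> D"
proof (rule ccontr)
  assume "\<not> thesis"
  then have "\<forall>\<^sub>F n in sequentially. D < e n" for D
    using that by (auto simp: frequently_def not_le)
  then have "filterlim e at_top sequentially"
    unfolding filterlim_at_top by (blast intro: eventually_mono less_imp_le)
  then have "(\<lambda>n. (1 / 2) ^ e n :: real) \<longlonglongrightarrow> 0"
    by (rule filterlim_compose[rotated]) (rule LIMSEQ_power_zero, simp)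
  moreover have "b n - a n = (1 / 2) ^ e n" for n
    using e[of n] by (simp add: std_dyadic_def power_divide)
  ultimately show False using assms(2) by simp
qed

lemma std_dyadic_pigeonhole:
  fixes A :: "nat set"
  assumes "infinite A" and e: "\<And>n. n \<in> A \<Longrightarrow> e n \<le> D"
    and std: "\<And>n. n \<in> A \<Longrightarrow> std_dyadic (e n) (a n) (b n)"
  obtains n n' m where "n < n'" "a n' = a n + of_int m" "b n' = b n + of_int m"
proof -
  define h where "h n = (e n, frac (a n))" for n
  have "h ` A \<subseteq> (SIGMA e:{..D}. fst ` {(a, b). std_dyadic e a b \<and> 0 \<le> a \<and> a \<le> 1})"
  proof (rule image_subsetI)
    fix n assume n: "n \<in> A"
    have "std_dyadic (e n) (frac (a n)) (b n - \<lfloor>a n\<rfloor>)"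
      using std[OF n] std_dyadic_add_Ints_iff[of "- of_int \<lfloor>a n\<rfloor>" "e n" "a n" "b n"]
      by (simp add: frac_def)
    then show "h n \<in> (SIGMA e:{..D}. fst ` {(a, b). std_dyadic e a b \<and> 0 \<le> a \<and> a \<le> 1})"
      using e[OF n] frac_lt_1[of "a n"] by (force simp: h_def)
  qed
  then have "finite (h ` A)"
    by (rule finite_subset) (intro finite_SigmaI finite_imageI finite_std_dyadic finite_atMost)
  then have "\<not> inj_on h A" using \<open>infinite A\<close> finite_imageD by blast
  then obtain n n' where n: "n \<in> A" "n' \<in> A" "n < n'" "h n' = h n"
    by (metis linorder_inj_onI')
  then obtain m :: int where m: "a n' = a n + of_int m"
    by (auto simp: h_def elim: frac_eqE)
  moreover have "b n' = b n + of_int m"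
    using m n std[OF n(1)] std[OF n(2)] by (simp add: h_def std_dyadic_def)
  ultimately show ?thesis using that n(3) by blast
qed

lemma (in circle_lift) fixed_point_mod_Ints:
  assumes "a \<le> b"
    and "F a \<le> a + of_int m \<and> b + of_int m \<le> F b \<or> a + of_int m \<le> F a \<and> F b \<le> b + of_int m"
  shows "\<exists>x. F x = x + of_int m"
proof -
  have cont: "continuous_on {a..b} (\<lambda>x. F x - x - of_int m)"
    by (intro continuous_intros continuous_on_subset[OF continuous]) simp
  have "\<exists>x\<ge>a. x \<le> b \<and> F x - x - of_int m = 0"
    using assms(2)
  proof
    assume "F a \<le> a + of_int m \<and> b + of_int m \<le> F b"
    then show ?thesis by (intro IVT' assms(1) cont) simp_all
  next
    assume "a + of_int m \<le> F a \<and> F b \<le> b + of_int m"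
    then show ?thesis by (intro IVT2' assms(1) cont) simp_all
  qed
  then show ?thesis by (auto simp: algebra_simps)
qed

context circle_lift
begin

interpretation iterate: circle_lift "F ^^ n" for n
  by (rule circle_lift_funpow[OF circle_lift_axioms])

definition has_periodic_point :: bool where
  "has_periodic_point \<longleftrightarrow> (\<exists>k>0. \<exists>x. \<exists>m::int. (F ^^ k) x = x + of_int m)"

lemma funpow_add_apply: "(F ^^ (m + n)) x = (F ^^ m) ((F ^^ n) x)"
  by (simp add: funpow_add)

lemma periodic_point_if_bounded_level:
  assumes "\<And>d. L d \<le> R d" "incseq L" "decseq R"
    and "\<exists>\<^sub>F n in sequentially. \<exists>d. \<exists>e\<le>D. std_dyadic e ((F ^^ n) (L d)) ((F ^^ n) (R d))"
  shows has_periodic_point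
proof -
  define A where "A = {n. \<exists>d. \<exists>e\<le>D. std_dyadic e ((F ^^ n) (L d)) ((F ^^ n) (R d))}"
  have "infinite A"
    using assms(4) by (simp add: A_def frequently_cofinite flip: cofinite_eq_sequentially)
  have "\<forall>n\<in>A. \<exists>d. \<exists>e\<le>D. std_dyadic e ((F ^^ n) (L d)) ((F ^^ n) (R d))"
    by (simp add: A_def)
  from bchoice[OF this] obtain d where
    "\<forall>n\<in>A. \<exists>e\<le>D. std_dyadic e ((F ^^ n) (L (d n))) ((F ^^ n) (R (d n)))" by blast
  from bchoice[OF this] obtain e where e: "\<And>n. n \<in> A \<Longrightarrow> e n \<le> D"
    and std: "\<And>n. n \<in> A \<Longrightarrow> std_dyadic (e n) ((F ^^ n) (L (d n))) ((F ^^ n) (R (d n)))"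
    by blast
  obtain n n' and m :: int where "n < n'"
    and m: "(F ^^ n') (L (d n')) = (F ^^ n) (L (d n)) + of_int m"
      "(F ^^ n') (R (d n')) = (F ^^ n) (R (d n)) + of_int m"
    by (rule std_dyadic_pigeonhole[OF \<open>infinite A\<close> e std]) auto
  from m have
    "(F ^^ (n' - n)) ((F ^^ n) (L (d n'))) = (F ^^ n) (L (d n)) + of_int m"
    "(F ^^ (n' - n)) ((F ^^ n) (R (d n'))) = (F ^^ n) (R (d n)) + of_int m"
    using \<open>n < n'\<close> by (simp_all flip: funpow_add_apply)
  moreover have "L (d n) \<le> L (d n') \<and> R (d n') \<le> R (d n) \<or>
      L (d n') \<le> L (d n) \<and> R (d n) \<le> R (d n')"
    using assms(2,3) unfolding incseq_def decseq_def by (meson nle_le)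
  ultimately have "\<exists>x. (F ^^ (n' - n)) x = x + of_int m"
    by (intro iterate.fixed_point_mod_Ints[of "(F ^^ n) (L (d n'))" "(F ^^ n) (R (d n'))"])
       (simp_all add: iterate.le_iff assms(1))
  then show ?thesis using \<open>n < n'\<close> unfolding has_periodic_point_def by (metis zero_less_diff)
qed

lemma funpow_maps_std_dyadic:
  assumes "maps_std_dyadic N F UNIV" "std_dyadic d a b" "Suc n * N \<le> d"
  obtains e where "N \<le> e" "std_dyadic e ((F ^^ n) a) ((F ^^ n) b)"
proof -
  have "\<exists>e. std_dyadic e ((F ^^ n) a) ((F ^^ n) b) \<and> d \<le> e + n * N" if "Suc n * N \<le> d" for n
    using that
  proof (induction n)
    case 0
    show ?case using assms(2) by auto
  next
    case (Suc n)
    then obtain e where e: "std_dyadic e ((F ^^ n) a) ((F ^^ n) b)" "d \<le> e + n * N" by auto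
    then have "N \<le> e" using Suc.prems by simp
    then obtain e' where "std_dyadic e' (F ((F ^^ n) a)) (F ((F ^^ n) b))" "e \<le> e' + N"
      using assms(1) e(1) unfolding maps_std_dyadic_def by blast
    then show ?case using e(2) by (intro exI[of _ e']) simp
  qed
  from this[OF assms(3)] obtain e where "std_dyadic e ((F ^^ n) a) ((F ^^ n) b)" "d \<le> e + n * N"
    by blast
  then show ?thesis using that[of e] assms(3) by simp
qed

lemma std_dyadic_images_dichotomy:
  assumes "maps_std_dyadic N F UNIV" "std_dyadic d a b"
  shows "(\<forall>n. \<exists>e\<ge>N. std_dyadic e ((F ^^ n) a) ((F ^^ n) b)) \<or>
    (\<exists>n. \<exists>e<N. std_dyadic e ((F ^^ n) a) ((F ^^ n) b))"
proof (cases "\<exists>n. \<exists>e<N. std_dyadic e ((F ^^ n) a) ((F ^^ n) b)")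
  case False
  have "\<exists>e\<ge>N. std_dyadic e ((F ^^ n) a) ((F ^^ n) b)" for n
  proof (induction n)
    case 0
    show ?case using False assms(2) by (metis funpow_0 not_le)
  next
    case (Suc n)
    then obtain e where "N \<le> e" "std_dyadic e ((F ^^ n) a) ((F ^^ n) b)" by blast
    then obtain e' where "std_dyadic e' (F ((F ^^ n) a)) (F ((F ^^ n) b))"
      using assms(1) unfolding maps_std_dyadic_def by blast
    then have "std_dyadic e' ((F ^^ Suc n) a) ((F ^^ Suc n) b)" by simp
    then show ?case using False not_le by blast
  qed
  then show ?thesis by blast
qed simp

definition contracts :: "real \<Rightarrow> real \<Rightarrow> bool" where
  "contracts a b \<longleftrightarrow> (\<lambda>n. (F ^^ n) b - (F ^^ n) a) \<longlonglongrightarrow> 0"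

lemma contracts_trans: "contracts a b \<Longrightarrow> contracts b c \<Longrightarrow> contracts a c"
  unfolding contracts_def by (drule (1) tendsto_add) simp

lemma not_contracts_0_1: "\<not> contracts 0 1"
proof -
  have "(F ^^ n) 1 - (F ^^ n) 0 = 1" for n
    using iterate.add_one[of n 0] by simp
  then show ?thesis by (simp add: contracts_def LIMSEQ_const_iff)
qed

lemma periodic_point_if_maps_std_dyadic:
  assumes N: "maps_std_dyadic N F UNIV"
  shows has_periodic_point
proof -
  obtain L R where std: "\<And>d. std_dyadic d (L d) (R d)" and LR: "incseq L" "decseq R"
    and not_contracts: "\<And>d. \<not> contracts (L d) (R d)"
    using dyadic_bisection[of contracts] contracts_trans not_contracts_0_1 by blast
  have "\<exists>D. \<exists>\<^sub>F n in sequentially. \<exists>d. \<exists>e\<le>D. std_dyadic e ((F ^^ n) (L d)) ((F ^^ n) (R d))"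
  proof (cases "\<exists>d n. \<forall>m. \<exists>e\<ge>N. std_dyadic e ((F ^^ (m + n)) (L d)) ((F ^^ (m + n)) (R d))")
    case True
    then obtain d n e where
      e: "\<And>m. std_dyadic (e m) ((F ^^ (m + n)) (L d)) ((F ^^ (m + n)) (R d))"
      by metis
    moreover have "\<not> (\<lambda>m. (F ^^ (m + n)) (R d) - (F ^^ (m + n)) (L d)) \<longlonglongrightarrow> 0"
      using not_contracts[of d] LIMSEQ_offset[of "\<lambda>m. (F ^^ m) (R d) - (F ^^ m) (L d)" n]
      unfolding contracts_def by blast
    ultimately obtain D where "\<exists>\<^sub>F m in sequentially. e m \<le> D"
      by (rule std_dyadic_frequently_bounded_level)
    then show ?thesis
      using e unfolding frequently_sequentially by (meson trans_le_add1)
  next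
    case False
    have "\<exists>n'\<ge>n. \<exists>d. \<exists>e\<le>N. std_dyadic e ((F ^^ n') (L d)) ((F ^^ n') (R d))" for n
    proof -
      define d where "d = Suc n * N"
      obtain e where "std_dyadic e ((F ^^ n) (L d)) ((F ^^ n) (R d))"
        using funpow_maps_std_dyadic[OF N std, of n d] unfolding d_def by blast
      from std_dyadic_images_dichotomy[OF N this] False
      have "\<exists>m. \<exists>e<N. std_dyadic e ((F ^^ (m + n)) (L d)) ((F ^^ (m + n)) (R d))"
        unfolding funpow_add_apply by blast
      then show ?thesis by (meson le_add2 less_imp_le)
    qed
    then show ?thesis unfolding frequently_sequentially by blast
  qed
  then show ?thesis
    using periodic_point_if_bounded_level[OF _ LR] std_dyadic_less[OF std]
    by (blast intro: less_imp_le)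
qed

end

lemma thompson_lift_has_periodic_point:
  assumes "thompson_lift F"
  shows "circle_lift.has_periodic_point F"
  using thompson_lift_maps_std_dyadic[OF assms]
    circle_lift.periodic_point_if_maps_std_dyadic[OF thompson_lift_circle_lift[OF assms]] by metis

section \<open>Wandering intervals\<close>

lemma funpow_leaves_fundamental_domain:
  fixes G :: "'a::linorder \<Rightarrow> 'a"
  assumes "strict_mono G" "0 < t"
    and x: "x \<in> {min c (G c)<..<max c (G c)}"
  shows "(G ^^ t) x \<notin> {min c (G c)<..<max c (G c)}"
proof -
  have less: "(G ^^ n) y < (G ^^ n) z \<longleftrightarrow> y < z" for n y z
    by (induction n) (simp_all add: strict_mono_less[OF assms(1)])
  note mono = strict_mono_mono[OF assms(1)]
  obtain n where t: "t = Suc n" using \<open>0 < t\<close> gr0_conv_Suc by blast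
  show ?thesis
  proof (cases "c \<le> G c")
    case True
    then have "G c \<le> (G ^^ t) c"
      using funpow_mono2[OF mono, of 1 t c c] by (simp add: t)
    also have "\<dots> \<le> (G ^^ t) x" using True x less[of t c x] by simp
    finally show ?thesis using True by (simp add: not_less)
  next
    case False
    have "(G ^^ Suc n) c \<le> G c"
    proof (induction n)
      case (Suc n)
      then have "(G ^^ Suc (Suc n)) c \<le> G (G c)" using mono by (simp add: monoD)
      also have "\<dots> \<le> G c" using False by (intro monoD[OF mono]) simp
      finally show ?case .
    qed simp
    then have "(G ^^ t) c \<le> G c" by (simp only: t)
    moreover have "(G ^^ t) x < (G ^^ t) c" using False x less[of t x c] by simp
    ultimately have "(G ^^ t) x \<le> G c" by simp
    then show ?thesis using False by (simp add: not_less)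
  qed
qed

context circle_lift
begin

interpretation iterate: circle_lift "F ^^ n" for n
  by (rule circle_lift_funpow[OF circle_lift_axioms])

lemma funpow_commute_apply: "(F ^^ m) ((F ^^ n) x) = (F ^^ n) ((F ^^ m) x)"
  by (simp add: add.commute flip: funpow_add_apply)

definition period_map :: "nat \<Rightarrow> int \<Rightarrow> real \<Rightarrow> real" where
  "period_map q p x = (F ^^ q) x - of_int p"

lemma strict_mono_period_map: "strict_mono (period_map q p)"
  by (simp add: period_map_def strict_mono_def iterate.less_iff)

lemma funpow_mult_period_map: "(F ^^ (q * t)) x = (period_map q p ^^ t) x + of_int (int t * p)"
proof (induction t)
  case (Suc t)
  have "(F ^^ (q * Suc t)) x = (F ^^ q) ((F ^^ (q * t)) x)"
    by (simp flip: funpow_add_apply)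
  also have "\<dots> = (F ^^ q) ((period_map q p ^^ t) x) + of_int (int t * p)"
    unfolding Suc by (rule iterate.add_int)
  also have "(F ^^ q) y = period_map q p y + of_int p" for y by (simp add: period_map_def)
  finally show ?case by (simp add: algebra_simps)
qed simp

lemma funpow_mult_periodic:
  assumes "(F ^^ q) x = x + of_int p"
  shows "(F ^^ (q * t)) x = x + of_int (int t * p)"
proof -
  have "(period_map q p ^^ t) x = x"
    by (induction t) (simp_all add: period_map_def assms)
  then show ?thesis using funpow_mult_period_map[of q t x p] by simp
qed

lemma funpow_mod_periodic:
  assumes "(F ^^ q) x = x + of_int p"
  shows "(F ^^ k) x = (F ^^ (k mod q)) x + of_int (int (k div q) * p)"
proof -
  have "(F ^^ k) x = (F ^^ (k mod q)) ((F ^^ (q * (k div q))) x)"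
    by (simp flip: funpow_add_apply)
  also have "\<dots> = (F ^^ (k mod q)) x + of_int (int (k div q) * p)"
    unfolding funpow_mult_periodic[OF assms] by (rule iterate.add_int)
  finally show ?thesis .
qed

definition minimal_period :: "real \<Rightarrow> nat \<Rightarrow> int \<Rightarrow> bool" where
  "minimal_period b q p \<longleftrightarrow> 0 < q \<and> (F ^^ q) b = b + of_int p \<and>
     (\<forall>k. \<forall>m::int. (F ^^ k) b = b + of_int m \<longrightarrow> q dvd k)"

lemma minimal_period_exists:
  assumes has_periodic_point
  obtains b q p where "minimal_period b q p"
proof -
  obtain k0 b and m0 :: int where k0: "0 < k0" "(F ^^ k0) b = b + of_int m0"
    using assms by (auto simp: has_periodic_point_def)
  define q where "q = (LEAST q. 0 < q \<and> (\<exists>p::int. (F ^^ q) b = b + of_int p))"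
  have "0 < q \<and> (\<exists>p::int. (F ^^ q) b = b + of_int p)"
    unfolding q_def by (rule LeastI[of _ k0]) (use k0 in blast)
  then obtain p :: int where q: "0 < q" "(F ^^ q) b = b + of_int p" by blast
  have "q dvd k" if k: "(F ^^ k) b = b + of_int m" for k and m :: int
  proof (rule ccontr)
    assume "\<not> q dvd k"
    then have "0 < k mod q" by (simp add: dvd_eq_mod_eq_0)
    have "(F ^^ (k mod q)) b = b + of_int (m - int (k div q) * p)"
      using k funpow_mod_periodic[OF q(2), of k] by simp
    with \<open>0 < k mod q\<close> have "q \<le> k mod q"
      unfolding q_def by (intro Least_le) blast
    then show False using mod_less_divisor[OF q(1), of k] by simp
  qed
  with q show ?thesis by (intro that[of b q p]) (simp add: minimal_period_def)
qed

definition lift_orbit :: "real \<Rightarrow> real set" where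
  "lift_orbit b = {(F ^^ r) b + of_int m | r m. True}"

lemma lift_orbitI: "(F ^^ r) b + of_int m \<in> lift_orbit b"
  by (auto simp: lift_orbit_def)

lemma lift_orbitE:
  assumes "x \<in> lift_orbit b"
  obtains r m where "x = (F ^^ r) b + of_int m"
  using assms by (auto simp: lift_orbit_def)

lemma periodic_orbit_iff:
  assumes "x \<in> lift_orbit b"
  shows "(F ^^ k) x = x + of_int m \<longleftrightarrow> (F ^^ k) b = b + of_int m"
proof -
  obtain r l where x: "x = (F ^^ r) b + of_int l" using assms by (rule lift_orbitE)
  have "(F ^^ k) x = (F ^^ r) ((F ^^ k) b) + of_int l"
    by (simp add: x iterate.add_int funpow_commute_apply)
  moreover have "x + of_int m = (F ^^ r) (b + of_int m) + of_int l"
    by (simp add: x iterate.add_int)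
  ultimately show ?thesis by (simp add: iterate.eq_iff)
qed

lemma funpow_in_lift_orbit_iff:
  assumes "0 < q" "(F ^^ q) b = b + of_int p"
  shows "(F ^^ k) x - of_int m \<in> lift_orbit b \<longleftrightarrow> x \<in> lift_orbit b"
proof
  assume "x \<in> lift_orbit b"
  then obtain r l where "x = (F ^^ r) b + of_int l" by (rule lift_orbitE)
  then have "(F ^^ k) x - of_int m = (F ^^ (k + r)) b + of_int (l - m)"
    by (simp add: iterate.add_int funpow_add_apply)
  then show "(F ^^ k) x - of_int m \<in> lift_orbit b" by (simp only: lift_orbitI)
next
  assume "(F ^^ k) x - of_int m \<in> lift_orbit b"
  then obtain r l where x: "(F ^^ k) x - of_int m = (F ^^ r) b + of_int l" by (rule lift_orbitE)
  define s where "s = r + q * k - k"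
  have "k + s = r + q * k" using \<open>0 < q\<close> by (cases q) (simp_all add: s_def)
  then have "(F ^^ k) ((F ^^ s) b) = (F ^^ r) b + of_int (int k * p)"
    using funpow_mult_periodic[OF assms(2), of k] iterate.add_int[of r b "int k * p"]
    by (simp flip: funpow_add_apply) (simp add: funpow_add_apply)
  then have "(F ^^ k) x = (F ^^ k) ((F ^^ s) b + of_int (l + m - int k * p))"
    unfolding iterate.add_int using x by simp
  then have "x = (F ^^ s) b + of_int (l + m - int k * p)" by (simp only: iterate.eq_iff)
  then show "x \<in> lift_orbit b" by (simp only: lift_orbitI)
qed

lemma lift_orbit_residueE:
  assumes "0 < q" "(F ^^ q) b = b + of_int p" "x \<in> lift_orbit b"
  obtains r m where "r < q" "x = (F ^^ r) b + of_int m"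
proof -
  obtain r l where x: "x = (F ^^ r) b + of_int l" using assms(3) by (rule lift_orbitE)
  have "x = (F ^^ (r mod q)) b + of_int (int (r div q) * p + l)"
    using x funpow_mod_periodic[OF assms(2), of r] by simp
  then show ?thesis using that \<open>0 < q\<close> mod_less_divisor by blast
qed

lemma lift_orbit_gap:
  assumes periodic: "0 < q" "(F ^^ q) b = b + of_int p"
  obtains a a' where "a \<in> lift_orbit b" "a' \<in> lift_orbit b" "a \<le> c" "c < a'"
    "lift_orbit b \<inter> {a<..<a'} = {}"
proof -
  define below where "below r = (F ^^ r) b + of_int \<lfloor>c - (F ^^ r) b\<rfloor>" for r
  define A where "A = below ` {..<q}"
  have A: "finite A" "A \<noteq> {}" using \<open>0 < q\<close> by (auto simp: A_def)
  have "A \<subseteq> lift_orbit b" by (auto simp: A_def below_def lift_orbitI)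
  then have "Max A \<in> lift_orbit b" "Min A \<in> lift_orbit b"
    using A Max_in Min_in by blast+
  moreover have "Min A + of_int 1 \<in> lift_orbit b"
    using \<open>Min A \<in> lift_orbit b\<close> funpow_in_lift_orbit_iff[OF periodic, of 0 "Min A" "- 1"] by simp
  moreover have "y \<le> c \<and> c < y + 1" if "y \<in> A" for y
    using that unfolding A_def below_def by (elim imageE) linarith
  then have "Max A \<le> c" "c < Min A + 1" using Max_in[OF A] Min_in[OF A] by blast+
  moreover have "x \<le> Max A \<or> Min A + 1 \<le> x" if x: "x \<in> lift_orbit b" for x
  proof -
    obtain r m where "r < q" and m: "x = (F ^^ r) b + of_int m"
      using periodic x by (rule lift_orbit_residueE)
    then have r: "below r \<in> A" by (simp add: A_def)
    show ?thesis
    proof (cases "m \<le> \<lfloor>c - (F ^^ r) b\<rfloor>")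
      case True
      then have "x \<le> below r" by (simp add: m below_def)
      also have "\<dots> \<le> Max A" using A(1) r by (rule Max_ge)
      finally show ?thesis by simp
    next
      case False
      have "Min A + 1 \<le> below r + 1" using Min_le[OF A(1) r] by simp
      also have "\<dots> \<le> x" using False by (simp add: m below_def)
      finally show ?thesis by simp
    qed
  qed
  then have "lift_orbit b \<inter> {Max A<..<Min A + 1} = {}" by force
  ultimately show ?thesis using that[of "Max A" "Min A + 1"] by simp
qed

lemma gap_return:
  assumes periodic: "0 < q" "(F ^^ q) b = b + of_int p"
    and a: "a \<in> lift_orbit b" and gap: "lift_orbit b \<inter> {a<..<a'} = {}"
    and x: "x \<in> {a<..<a'}" and y: "y \<in> {a<..<a'}" and return: "(F ^^ k) x = y + of_int m"
  shows "(F ^^ k) a = a + of_int m"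
proof (rule antisym)
  have le: "z \<le> a" if "z \<in> lift_orbit b" "z < a'" for z
    using gap that by force
  have "(F ^^ k) a - of_int m \<in> lift_orbit b"
    using a funpow_in_lift_orbit_iff[OF periodic] by simp
  moreover have "(F ^^ k) a < (F ^^ k) x" using x by (simp add: iterate.less_iff)
  ultimately show "(F ^^ k) a \<le> a + of_int m"
    using le[of "(F ^^ k) a - of_int m"] return y by simp
next
  define w where "w = inv_fun (F ^^ k) (a + of_int m)"
  have w: "(F ^^ k) w = a + of_int m" by (simp add: w_def)
  then have "w \<in> lift_orbit b" using a funpow_in_lift_orbit_iff[OF periodic, of k w m] by simp
  moreover have "(F ^^ k) w < (F ^^ k) x" using w return y by simp
  ultimately have "w \<le> a" using gap x by (force simp: iterate.less_iff)
  then show "a + of_int m \<le> (F ^^ k) a" unfolding w[symmetric] by (simp only: iterate.le_iff)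
qed

lemma gap_return_multiple:
  assumes minimal: "minimal_period b q p"
    and gap: "a \<in> lift_orbit b" "lift_orbit b \<inter> {a<..<a'} = {}"
      "x \<in> {a<..<a'}" "y \<in> {a<..<a'}" "(F ^^ k) x = y + of_int m"
  obtains t where "k = q * t" "m = int t * p"
proof -
  have periodic: "0 < q" "(F ^^ q) b = b + of_int p"
    using minimal by (simp_all add: minimal_period_def)
  have b: "(F ^^ k) b = b + of_int m"
    using gap_return[OF periodic gap] periodic_orbit_iff[OF gap(1)] by simp
  then obtain t where t: "k = q * t" using minimal unfolding minimal_period_def by blast
  then have "real_of_int m = of_int (int t * p)"
    using b funpow_mult_periodic[OF periodic(2), of t] by (simp del: of_int_mult)
  then show ?thesis using that t by (simp only: of_int_eq_iff)
qed

lemma period_map_orbit: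
  assumes "(F ^^ q) b = b + of_int p" "x \<in> lift_orbit b"
  shows "period_map q p x = x"
  using periodic_orbit_iff[OF assms(2), of q p] assms(1) by (simp add: period_map_def)

definition wandering_interval :: "real \<Rightarrow> real \<Rightarrow> bool" where
  "wandering_interval u v \<longleftrightarrow> (\<forall>k x y. \<forall>m::int. x \<in> {u<..<v} \<longrightarrow> y \<in> {u<..<v} \<longrightarrow>
     (F ^^ k) x = y + of_int m \<longrightarrow> frac \<circ> (F ^^ k) = frac)"

lemma wandering_intervalD:
  "wandering_interval u v \<Longrightarrow> x \<in> {u<..<v} \<Longrightarrow> y \<in> {u<..<v} \<Longrightarrow> (F ^^ k) x = y + of_int m \<Longrightarrow>
    frac \<circ> (F ^^ k) = frac"
  unfolding wandering_interval_def by blast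

lemma wandering_gap:
  assumes minimal: "minimal_period b q p" and trivial: "\<And>x. period_map q p x = x"
    and gap: "a \<in> lift_orbit b" "lift_orbit b \<inter> {a<..<a'} = {}"
  shows "wandering_interval a a'"
  unfolding wandering_interval_def
proof (intro allI impI)
  fix k x y and m :: int
  assume "x \<in> {a<..<a'}" "y \<in> {a<..<a'}" "(F ^^ k) x = y + of_int m"
  then obtain t where k: "k = q * t" and "m = int t * p"
    by (rule gap_return_multiple[OF minimal gap])
  have "(period_map q p ^^ t) z = z" for z
    by (induction t) (simp_all add: trivial)
  then have "(F ^^ k) z = z + of_int (int t * p)" for z
    unfolding k funpow_mult_period_map[of q t z p] by simp
  then show "frac \<circ> (F ^^ k) = frac" by (simp add: fun_eq_iff del: of_int_mult)
qed

lemma wandering_fundamental_domain: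
  assumes minimal: "minimal_period b q p"
    and gap: "a \<in> lift_orbit b" "lift_orbit b \<inter> {a<..<a'} = {}" and "a' \<in> lift_orbit b"
    and c: "c \<in> {a<..<a'}"
  shows "wandering_interval (min c (period_map q p c)) (max c (period_map q p c))"
  unfolding wandering_interval_def
proof (intro allI impI)
  let ?G = "period_map q p"
  let ?I = "{min c (?G c)<..<max c (?G c)}"
  fix k x y and m :: int
  assume x: "x \<in> ?I" and y: "y \<in> ?I" and return: "(F ^^ k) x = y + of_int m"
  have "?G a = a" "?G a' = a'"
    using minimal gap(1) \<open>a' \<in> lift_orbit b\<close>
    by (auto simp: minimal_period_def intro: period_map_orbit)
  then have "?G c \<in> {a<..<a'}"
    using c strict_monoD[OF strict_mono_period_map, of a c q p]
      strict_monoD[OF strict_mono_period_map, of c a' q p] by simp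
  then have "x \<in> {a<..<a'}" "y \<in> {a<..<a'}" using x y c by auto
  then obtain t where t: "k = q * t" "m = int t * p"
    using return by (rule gap_return_multiple[OF minimal gap])
  then have "(?G ^^ t) x = y" using return funpow_mult_period_map[of q t x p] by simp
  then have "t = 0"
    using funpow_leaves_fundamental_domain[OF strict_mono_period_map, of t x c q p] x y by blast
  then show "frac \<circ> (F ^^ k) = frac" by (simp add: t(1) fun_eq_iff)
qed

lemma wandering_interval_exists:
  assumes has_periodic_point
  obtains u v where "u < v" "wandering_interval u v"
proof -
  obtain b q p where minimal: "minimal_period b q p"
    using assms by (rule minimal_period_exists)
  then have periodic: "0 < q" "(F ^^ q) b = b + of_int p" by (simp_all add: minimal_period_def)
  show ?thesis
  proof (cases "\<forall>x. period_map q p x = x")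
    case True
    obtain a a' where "a \<in> lift_orbit b" "lift_orbit b \<inter> {a<..<a'} = {}" "a \<le> b" "b < a'"
      using lift_orbit_gap[OF periodic, of b] by metis
    then show ?thesis using that[of a a'] wandering_gap[OF minimal] True by simp
  next
    case False
    then obtain c where c: "period_map q p c \<noteq> c" by blast
    obtain a a' where gap: "a \<in> lift_orbit b" "lift_orbit b \<inter> {a<..<a'} = {}" "a' \<in> lift_orbit b"
      and "a \<le> c" "c < a'"
      using lift_orbit_gap[OF periodic, of c] by metis
    then have "c \<in> {a<..<a'}"
      using c period_map_orbit[OF periodic(2)] by (auto simp: order_le_less)
    with minimal gap have "wandering_interval (min c (period_map q p c)) (max c (period_map q p c))"
      by (rule wandering_fundamental_domain)
    moreover have "min c (period_map q p c) < max c (period_map q p c)" using c by simp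
    ultimately show ?thesis using that by blast
  qed
qed

end

section \<open>Squeezing an arc into another one\<close>

text \<open>On \<open>[0, 1]\<close> this is the standard generator \<open>x\<^sub>0\<close> of Thompson's group \<open>F\<close>.\<close>

definition push :: "real \<Rightarrow> real" where
  "push x = x + min (frac x) (min (1 / 4) ((1 - frac x) / 2))"

lemma push_cases:
  obtains "push x = x + frac x" "frac x \<le> 1 / 4"
  | "push x = x + 1 / 4" "1 / 4 \<le> frac x" "frac x \<le> 1 / 2"
  | "push x = x + (1 - frac x) / 2" "1 / 2 \<le> frac x"
proof -
  consider "frac x \<le> 1 / 4" | "1 / 4 \<le> frac x" "frac x \<le> 1 / 2" | "1 / 2 \<le> frac x"
    by linarith
  then show ?thesis
    by cases (use that in \<open>auto simp: push_def min_def\<close>)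
qed

lemma push_unit_interval:
  assumes "0 \<le> x" "x < 1"
  shows "push x = x + min x (min (1 / 4) ((1 - x) / 2))"
  using assms by (simp add: push_def)

lemma push_bilipschitz:
  assumes "x \<le> y"
  shows "(y - x) / 2 \<le> push y - push x \<and> push y - push x \<le> 2 * (y - x)"
proof -
  define s t i j where "s = frac x" and "t = frac y"
    and "i = real_of_int \<lfloor>x\<rfloor>" and "j = real_of_int \<lfloor>y\<rfloor>"
  have st: "0 \<le> s" "s < 1" "0 \<le> t" "t < 1" by (simp_all add: s_def t_def frac_lt_1)
  have xy: "x = i + s" "y = j + t" by (simp_all add: s_def t_def i_def j_def frac_def)
  have "\<lfloor>x\<rfloor> = \<lfloor>y\<rfloor> \<or> \<lfloor>x\<rfloor> + 1 \<le> \<lfloor>y\<rfloor>"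
    using floor_mono[OF assms] by linarith
  then have "i = j \<or> i + 1 \<le> j" unfolding i_def j_def by (elim disjE) linarith+
  moreover have "push x = x + s \<and> s \<le> 1 / 4 \<or> push x = x + 1 / 4 \<and> 1 / 4 \<le> s \<and> s \<le> 1 / 2 \<or>
      push x = x + (1 - s) / 2 \<and> 1 / 2 \<le> s"
    unfolding s_def by (cases x rule: push_cases) simp_all
  moreover have "push y = y + t \<and> t \<le> 1 / 4 \<or> push y = y + 1 / 4 \<and> 1 / 4 \<le> t \<and> t \<le> 1 / 2 \<or>
      push y = y + (1 - t) / 2 \<and> 1 / 2 \<le> t"
    unfolding t_def by (cases y rule: push_cases) simp_all
  ultimately show ?thesis using assms st unfolding xy by argo
qed

lemma circle_lift_push: "circle_lift push"
proof
  show "strict_mono push"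
  proof (rule strict_monoI)
    fix x y :: real assume "x < y"
    then show "push x < push y" using push_bilipschitz[of x y] by simp
  qed
  show "push (x + 1) = push x + 1" for x
    by (simp add: push_def frac_1_eq)
  show "continuous_on UNIV push"
  proof (intro continuous_at_imp_continuous_on ballI, unfold isCont_def, rule LIM_I)
    fix x e :: real assume "e > 0"
    have "\<bar>push y - push x\<bar> < e" if "\<bar>y - x\<bar> < e / 2" for y
      using push_bilipschitz[of x y] push_bilipschitz[of y x] that by (cases "x \<le> y") auto
    then show "\<exists>d>0. \<forall>y. y \<noteq> x \<and> norm (y - x) < d \<longrightarrow> norm (push y - push x) < e"
      using \<open>e > 0\<close> by (intro exI[of _ "e / 2"]) auto
  qed
qed

lemma dyadic_push_iff: "dyadic (push x) \<longleftrightarrow> dyadic x"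
proof (cases x rule: push_cases)
  case 1
  then have "push x = 2 * x + of_int (- \<lfloor>x\<rfloor>)" by (simp add: frac_def)
  then show ?thesis by (simp only: dyadic_add_iff dyadic_double_iff dyadic_int Ints_of_int)
next
  case 2
  then have "push x = x + 1 / 2 ^ 2" by simp
  then show ?thesis by (simp only: dyadic_add_iff dyadic_inverse_power2)
next
  case 3
  then have "2 * push x = x + of_int (\<lfloor>x\<rfloor> + 1)" by (simp add: frac_def field_simps)
  then show ?thesis
    using dyadic_double_iff[of "push x"] by (simp only: dyadic_add_iff dyadic_int Ints_of_int)
qed

lemma breakpoints_push: "breakpoints push \<inter> {0..1} \<subseteq> {0, 1 / 2 ^ 2, 1 / 2 ^ 1, 1}"
proof (rule subsetI, rule ccontr)
  fix x assume x: "x \<in> breakpoints push \<inter> {0..1}" "x \<notin> {0, 1 / 2 ^ 2, 1 / 2 ^ 1, 1}"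
  consider "0 < x" "x < 1 / 4" | "1 / 4 < x" "x < 1 / 2" | "1 / 2 < x" "x < 1"
    using x by force
  then have "x \<notin> breakpoints push"
  proof cases
    case 1
    then show ?thesis
      by (rule not_breakpoint_if_affine[of _ _ _ _ 1 0]) (simp add: push_unit_interval)
  next
    case 2
    then show ?thesis
      by (rule not_breakpoint_if_affine[of _ _ _ _ 0 "1 / 4"]) (simp add: push_unit_interval)
  next
    case 3
    then show ?thesis
      by (rule not_breakpoint_if_affine[of _ _ _ _ "- 1" "1 / 2"])
         (simp add: push_unit_interval powr_minus field_simps)
  qed
  then show False using x(1) by blast
qed

lemma thompson_lift_push: "thompson_lift push"
  unfolding thompson_lift_iff_unit_interval
proof (intro conjI exI[of _ "{0, 1 / 2 ^ 2, 1 / 2 ^ 1, 1}"] allI)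
  show "\<forall>b\<in>{0, 1 / 2 ^ 2, 1 / 2 ^ 1, 1}. dyadic b"
    by (simp only: ball_simps dyadic_inverse_power2 dyadic_int Ints_0 Ints_1 simp_thms)
  show "\<forall>x\<in>{0..1} - {0, 1 / 2 ^ 2, 1 / 2 ^ 1, 1}. x \<notin> breakpoints push"
    using breakpoints_push by blast
qed (simp_all add: circle_lift_push dyadic_push_iff)

lemma push_funpow_to_half: "(push ^^ n) (1 / 2 ^ Suc n) = 1 / 2"
proof (induction n)
  case (Suc n)
  define y :: real where "y = 1 / 2 ^ Suc (Suc n)"
  have "0 < y" "y \<le> 1 / 4" by (simp_all add: y_def field_simps)
  then have "push y = 2 * y" by (simp add: push_unit_interval min_def)
  then have "push (1 / 2 ^ Suc (Suc n)) = 1 / 2 ^ Suc n" by (simp add: y_def)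
  then show ?case using Suc by (simp add: funpow_swap1)
qed simp

lemma push_funpow_from_half: "(push ^^ n) (1 / 2) = 1 - 1 / 2 ^ Suc n"
proof (induction n)
  case (Suc n)
  define y :: real where "y = 1 / 2 ^ Suc n"
  have "0 < y" "y \<le> 1 / 2" by (simp_all add: y_def field_simps)
  then have "push (1 - y) = 1 - y / 2" by (simp add: push_unit_interval min_def)
  then show ?case using Suc by (simp add: y_def)
qed simp

lemma thompson_lift_into_interval:
  assumes "u < v" "dyadic j"
  obtains F where "thompson_lift F" "\<And>x. j + 1 / 2 ^ Suc m \<le> x \<Longrightarrow> x < j + 1 \<Longrightarrow> F x \<in> {u<..<v}"
proof -
  obtain n where "(1 / 2) ^ n < v - u"
    using real_arch_pow_inv[of "v - u" "1 / 2"] \<open>u < v\<close> by auto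
  then have n: "2 * (1 / 2 ^ Suc n) < v - u" by (simp add: power_divide)
  obtain s t where st: "std_dyadic (Suc n) s t" "s \<le> v" "v < t" by (rule std_dyadic_cover)
  define F where "F = (\<lambda>x. x + (s + - 1)) \<circ> push ^^ (n + m) \<circ> (\<lambda>x. x + - j)"
  have F: "thompson_lift F"
    unfolding F_def using \<open>dyadic j\<close> std_dyadic_imp_dyadic[OF st(1)]
    by (intro thompson_lift_comp thompson_lift_add thompson_lift_funpow thompson_lift_push
        dyadic_add) simp_all
  then interpret circle_lift F by (rule thompson_lift_circle_lift)
  have "(push ^^ (n + m)) (1 / 2 ^ Suc m) = 1 - 1 / 2 ^ Suc n"
    by (simp only: funpow_add comp_apply push_funpow_to_half push_funpow_from_half)
  then have low: "F (j + 1 / 2 ^ Suc m) = s - 1 / 2 ^ Suc n" by (simp add: F_def)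
  have "(push ^^ i) 0 = 0" for i
    by (induction i) (simp_all add: push_def)
  then have "F j = s - 1" by (simp add: F_def)
  then have high: "F (j + 1) = s" by (simp add: add_one)
  have "F x \<in> {u<..<v}" if x: "j + 1 / 2 ^ Suc m \<le> x" "x < j + 1" for x
  proof -
    have "s - 1 / 2 ^ Suc n \<le> F x" using x(1) le_iff low by metis
    moreover have "F x < s" using x(2) less_iff high by metis
    moreover have "v < s + 1 / 2 ^ Suc n" using st by (simp add: std_dyadic_def)
    ultimately show ?thesis using st(2) n by simp
  qed
  with F show ?thesis using that by blast
qed

section \<open>Thompson's group acting on the circle\<close>

lemma thompson_T_simps:
  "carrier thompson_T = thompson_T_set" "mult thompson_T = (\<circ>)" "one thompson_T = frac"
  by (simp_all add: thompson_T_def)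

lemma thompson_TI: "thompson_lift F \<Longrightarrow> frac \<circ> F \<in> carrier thompson_T"
  by (auto simp: thompson_T_simps thompson_T_set_def comp_def)

lemma thompson_TE:
  assumes "f \<in> carrier thompson_T"
  obtains F where "thompson_lift F" "f = frac \<circ> F"
  using assms by (auto simp: thompson_T_simps thompson_T_set_def comp_def)

lemma frac_lift_comp:
  assumes "circle_lift F"
  shows "(frac \<circ> F) \<circ> (frac \<circ> G) = frac \<circ> (F \<circ> G)"
  using circle_lift.frac_apply_frac[OF assms] by (simp add: fun_eq_iff)

lemma group_thompson_T: "group thompson_T"
proof (rule groupI)
  fix f g assume "f \<in> carrier thompson_T" "g \<in> carrier thompson_T"
  then obtain F G where "thompson_lift F" "f = frac \<circ> F" "thompson_lift G" "g = frac \<circ> G"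
    by (elim thompson_TE)
  then show "f \<otimes>\<^bsub>thompson_T\<^esub> g \<in> carrier thompson_T"
    using thompson_TI[OF thompson_lift_comp]
    by (simp add: thompson_T_simps(2) frac_lift_comp thompson_lift_circle_lift)
next
  have "thompson_lift (\<lambda>x. x + 0)" by (rule thompson_lift_add) simp
  then have "frac \<circ> (\<lambda>x. x + 0) \<in> carrier thompson_T" by (rule thompson_TI)
  then show "\<one>\<^bsub>thompson_T\<^esub> \<in> carrier thompson_T"
    by (simp add: thompson_T_simps(3) comp_def)
next
  fix f assume "f \<in> carrier thompson_T"
  then obtain F where F: "thompson_lift F" "f = frac \<circ> F" by (rule thompson_TE)
  then show "\<one>\<^bsub>thompson_T\<^esub> \<otimes>\<^bsub>thompson_T\<^esub> f = f"
    by (auto simp: thompson_T_simps)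
  note inv = thompson_lift_inv[OF F(1)]
  have "(frac \<circ> inv_fun F) \<otimes>\<^bsub>thompson_T\<^esub> f = \<one>\<^bsub>thompson_T\<^esub>"
    unfolding F(2) thompson_T_simps frac_lift_comp[OF thompson_lift_circle_lift[OF inv]]
    using circle_lift.inv_F[OF thompson_lift_circle_lift[OF F(1)]] by (simp add: fun_eq_iff)
  then show "\<exists>g\<in>carrier thompson_T. g \<otimes>\<^bsub>thompson_T\<^esub> f = \<one>\<^bsub>thompson_T\<^esub>"
    using thompson_TI[OF inv] by blast
qed (auto simp: thompson_T_simps)

lemma thompson_T_range: "f \<in> carrier thompson_T \<Longrightarrow> f x \<in> {0..<1}"
  by (auto elim!: thompson_TE simp: frac_lt_1)

interpretation T: group thompson_T
  by (rule group_thompson_T)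

lemma restrict_thompson_T_Bij:
  assumes f: "f \<in> carrier thompson_T"
  shows "restrict f {0..<1} \<in> Bij {0..<1}"
proof -
  define g where "g = inv\<^bsub>thompson_T\<^esub> f"
  have g: "g \<in> carrier thompson_T" using f by (simp add: g_def)
  have "f \<circ> g = frac" "g \<circ> f = frac"
    using T.r_inv[OF f] T.l_inv[OF f] by (simp_all add: g_def thompson_T_simps)
  then have "f (g x) = frac x" "g (f x) = frac x" for x
    by (simp_all add: fun_eq_iff)
  then have "bij_betw f {0..<1} {0..<1}"
    using thompson_T_range[OF f] thompson_T_range[OF g] by (intro bij_betw_byWitness[of _ g]) auto
  then show ?thesis by (simp add: Bij_def)
qed

interpretation T: group_action thompson_T "{0..<1}" "\<lambda>f. restrict f {0..<1}"
proof (intro group_action.intro group_hom.intro group_hom_axioms.intro homI)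
  show "group thompson_T" by (rule group_thompson_T)
  show "group (BijGroup {0..<1::real})" by (rule group_BijGroup)
next
  fix f g assume f: "f \<in> carrier thompson_T" and g: "g \<in> carrier thompson_T"
  show "restrict f {0..<1} \<in> carrier (BijGroup {0..<1})"
    using restrict_thompson_T_Bij[OF f] by (simp add: BijGroup_def)
  have "restrict (f \<circ> g) {0..<1} = compose {0..<1} (restrict f {0..<1}) (restrict g {0..<1})"
    using thompson_T_range[OF g] by (auto simp: fun_eq_iff compose_def)
  then show "restrict (f \<otimes>\<^bsub>thompson_T\<^esub> g) {0..<1} =
      restrict f {0..<1} \<otimes>\<^bsub>BijGroup {0..<1}\<^esub> restrict g {0..<1}"
    by (simp add: BijGroup_def thompson_T_simps(2) restrict_thompson_T_Bij f g)
qed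

lemma thompson_T_nat_pow:
  assumes "thompson_lift F"
  shows "(frac \<circ> F) [^]\<^bsub>thompson_T\<^esub> (n::nat) = frac \<circ> (F ^^ n)"
proof (induction n)
  case 0
  show ?case by (simp add: thompson_T_simps)
next
  case (Suc n)
  have "(frac \<circ> F) [^]\<^bsub>thompson_T\<^esub> Suc n = (frac \<circ> (F ^^ n)) \<circ> (frac \<circ> F)"
    by (simp only: T.nat_pow_Suc Suc thompson_T_simps(2))
  also have "\<dots> = frac \<circ> (F ^^ n \<circ> F)"
    by (intro frac_lift_comp thompson_lift_circle_lift thompson_lift_funpow assms)
  finally show ?case by (simp only: funpow_Suc_right)
qed

lemma thompson_T_wandering_interval:
  assumes s: "s \<in> carrier thompson_T"
  obtains u v where "u < v" "T.wandering s (frac ` {u<..<v})"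
proof -
  obtain F where F: "thompson_lift F" "s = frac \<circ> F" using s by (rule thompson_TE)
  interpret circle_lift F by (rule thompson_lift_circle_lift[OF F(1)])
  obtain u v where "u < v" and uv: "wandering_interval u v"
    using thompson_lift_has_periodic_point[OF F(1)] by (rule wandering_interval_exists)
  have "T.wandering s (frac ` {u<..<v})"
  proof (rule T.wanderingI_nat[OF s])
    show "frac ` {u<..<v} \<subseteq> {0..<1}" by (auto simp: frac_lt_1)
    fix n :: nat and z
    assume z: "z \<in> frac ` {u<..<v}" "restrict (s [^]\<^bsub>thompson_T\<^esub> n) {0..<1} z \<in> frac ` {u<..<v}"
    then obtain x y where xy: "x \<in> {u<..<v}" "z = frac x" "y \<in> {u<..<v}"
      "frac ((F ^^ n) z) = frac y"
      by (auto simp: F(2) thompson_T_nat_pow[OF F(1)] frac_lt_1)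
    then have "frac ((F ^^ n) x) = frac y"
      using circle_lift.frac_apply_frac[OF circle_lift_funpow[OF circle_lift_axioms]] by simp
    then obtain m :: int where "(F ^^ n) x = y + of_int m" by (rule frac_eqE)
    then show "s [^]\<^bsub>thompson_T\<^esub> n = \<one>\<^bsub>thompson_T\<^esub>"
      using wandering_intervalD[OF uv xy(1,3)]
      by (simp add: F(2) thompson_T_nat_pow[OF F(1)] thompson_T_simps(3))
  qed
  with \<open>u < v\<close> show ?thesis by (rule that)
qed

definition dyadic_shell :: "nat \<Rightarrow> real set" where
  "dyadic_shell n = {1 / 2 ^ Suc (Suc n)..<1 / 2 ^ Suc n}"

lemma disjoint_family_dyadic_shell: "disjoint_family dyadic_shell"
proof -
  have "x \<notin> dyadic_shell n" if "x \<in> dyadic_shell m" "m < n" for x m n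
  proof -
    have "1 / 2 ^ Suc n \<le> (1 / 2 ^ Suc (Suc m) :: real)"
      using \<open>m < n\<close> by (intro divide_left_mono power_increasing) simp_all
    then show ?thesis using that(1) by (simp add: dyadic_shell_def)
  qed
  then show ?thesis unfolding disjoint_family_on_def by (metis disjoint_iff linorder_neqE_nat)
qed

lemma dyadic_shell_less_half: "x \<in> dyadic_shell n \<Longrightarrow> x < 1 / 2"
proof -
  assume "x \<in> dyadic_shell n"
  then have "x < 1 / 2 ^ Suc n" by (simp add: dyadic_shell_def)
  also have "\<dots> \<le> 1 / 2" by (simp add: field_simps)
  finally show ?thesis .
qed

lemma thompson_T_conj_wandering:
  assumes s: "s \<in> carrier thompson_T"
  shows "\<exists>g\<in>carrier thompson_T. T.wandering
    (inv\<^bsub>thompson_T\<^esub> g \<otimes>\<^bsub>thompson_T\<^esub> s \<otimes>\<^bsub>thompson_T\<^esub> g) ({0..<1} - dyadic_shell n)"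
proof -
  obtain u v where "u < v" and wandering: "T.wandering s (frac ` {u<..<v})"
    using s by (rule thompson_T_wandering_interval)
  define j where "j = 1 / (2::real) ^ Suc (Suc n)"
  obtain F where F: "thompson_lift F"
      "\<And>x. j + 1 / 2 ^ Suc (Suc n) \<le> x \<Longrightarrow> x < j + 1 \<Longrightarrow> F x \<in> {u<..<v}"
    using thompson_lift_into_interval[OF \<open>u < v\<close>, of j "Suc n"] dyadic_inverse_power2
    unfolding j_def by metis
  interpret circle_lift F by (rule thompson_lift_circle_lift[OF F(1)])
  have shell: "dyadic_shell n = {j..<j + 1 / 2 ^ Suc (Suc n)}" and "0 < j"
    by (simp_all add: dyadic_shell_def j_def)
  have "frac (F x) \<in> frac ` {u<..<v}" if x: "x \<in> {0..<1} - dyadic_shell n" for x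
  proof (cases "j \<le> x")
    case True
    then show ?thesis using x F(2)[of x] \<open>0 < j\<close> by (auto simp: shell)
  next
    case False
    moreover have "j + 1 / 2 ^ Suc (Suc n) \<le> 1"
      using one_le_power[of "2::real" "Suc n"] by (simp add: j_def field_simps)
    ultimately have "F (x + 1) \<in> {u<..<v}" using x F(2)[of "x + 1"] by auto
    moreover have "frac (F (x + 1)) = frac (F x)" by (simp add: add_one frac_1_eq)
    ultimately show ?thesis by (metis imageI)
  qed
  then have "restrict (frac \<circ> F) {0..<1} ` ({0..<1} - dyadic_shell n) \<subseteq> frac ` {u<..<v}"
    by auto
  then show ?thesis
    using T.wandering_conj[OF thompson_TI[OF F(1)] s wandering] thompson_TI[OF F(1)] by blast
qed

theorem theorem4p6:
  shows "\<not> invariably_generated thompson_T"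
proof (rule T.not_invariably_generated_if_ping_pong)
  show "countable (carrier thompson_T)"
    by (simp add: thompson_T_simps countable_thompson_T_set)
  show "disjoint_family dyadic_shell" by (rule disjoint_family_dyadic_shell)
  show "\<exists>g\<in>carrier thompson_T. T.wandering
      (inv\<^bsub>thompson_T\<^esub> g \<otimes>\<^bsub>thompson_T\<^esub> s \<otimes>\<^bsub>thompson_T\<^esub> g) ({0..<1} - dyadic_shell n)"
    if "s \<in> carrier thompson_T" for s n
    using that by (rule thompson_T_conj_wandering)
  show "1 / 2 \<in> {0..<1::real}" "1 / 2 \<notin> dyadic_shell n" for n
    using dyadic_shell_less_half by force+
  show "frac \<circ> (\<lambda>x. x + 1 / 2 ^ 2) \<in> carrier thompson_T"
    by (intro thompson_TI thompson_lift_add dyadic_inverse_power2)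
  show "restrict (frac \<circ> (\<lambda>x. x + 1 / 2 ^ 2)) {0..<1} (1 / 2) \<notin>
      insert (1 / 2) (\<Union>n. dyadic_shell n)"
    using dyadic_shell_less_half[of "3 / 4"] by force
qed

end
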